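(* Let $G_0\in\mathbb{Q}[x,y]$ be a non-constant form. Let $p$ be a good prime associated with $G_0$, and let $G_p$ be the image of $G_0$ in $\mathbb{F}_p[x,y]$. If $\operatorname{fpt}(G_p)\ne\operatorname{lct}(G_0)$, then the minimal denominator of $\operatorname{fpt}(G_p)$ is of the form $kp^e$, where $e\ge 1$ and $k$ divides the multiplicity of some linear factor (over $\mathbb{C}$) of $G_0$.
   Context: A form is a nonzero homogeneous polynomial (standard grading). A prime $p$ is a good prime associated with a non-constant form $G_0\in\mathbb{Q}[x,y]$ if there exists a reduction modulo $p$ of $G_0$ in $\mathbb{F}_p[x,y]$ (i.e. $p$ divides no denominator of a coefficient of $G_0$), denoted $G_p$, and the factorization of $G_p$ over $\overline{\mathbb{F}}_p$ is similar to the factorization of $G_0$ over $\mathbb{C}$, in the sense that those factorizations have the same number of pairwise prime linear factors and the same multiplicities. For a polynomial $g$ with $g(0,0)=0$ over a field of characteristic $p>0$ in variables $x,y$, the $F$-pure threshold (at the origin) is $\operatorname{fpt}(g)=\inf\{a/p^e : a,e\in\mathbb{N},\ g^a\in\langle x^{p^e},y^{p^e}\rangle\}$; it is known to be rational. $\operatorname{lct}(G_0)$ is the usual log canonical threshold of $G_0$ at the origin, defined via a log resolution; it satisfies $\operatorname{lct}(G_0)=\lim_{p\to\infty}\operatorname{fpt}(G_p)$. *)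

theory Defs
  imports
    Complex_Main
    "HOL-Computational_Algebra.Computational_Algebra"
    "HOL-Algebra.Algebraic_Closure_Type"
    "Berlekamp_Zassenhaus.Finite_Field"
begin

section \<open>Polynomials in two variables\<close>

text \<open>
  An element of \<open>k[x,y]\<close> is an element of \<open>k[x][y]\<close>: the inner variable is \<open>x\<close>, the outer
  variable is \<open>y\<close>, and the coefficient of \<open>x^i * y^j\<close> in \<open>F\<close> is \<open>coeff (coeff F j) i\<close>.
\<close>

type_synonym 'a bipoly = "'a poly poly"

definition var_x :: "'a::comm_ring_1 bipoly" where "var_x = [:[:0, 1:]:]"
definition var_y :: "'a::comm_ring_1 bipoly" where "var_y = [:0, 1:]"
definition const :: "'a::comm_ring_1 \<Rightarrow> 'a bipoly" where "const c = [:[:c:]:]"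

definition map_bipoly :: "('a::comm_ring_1 \<Rightarrow> 'b::comm_ring_1) \<Rightarrow> 'a bipoly \<Rightarrow> 'b bipoly" where
  "map_bipoly h F = map_poly (map_poly h) F"

definition subst_xy :: "'a::comm_ring_1 bipoly \<Rightarrow> 'a bipoly \<Rightarrow> 'a bipoly \<Rightarrow> 'a bipoly" where
  "subst_xy F a b = poly (map_poly (\<lambda>q. poly (map_poly const q) a) F) b"

definition at_origin :: "'a::comm_ring_1 bipoly \<Rightarrow> 'a" where
  "at_origin F = coeff (coeff F 0) 0"

text \<open>\<open>is_form d F\<close>: \<open>F\<close> is a nonzero homogeneous polynomial of degree \<open>d\<close>.\<close>

definition is_form :: "nat \<Rightarrow> 'a::comm_ring_1 bipoly \<Rightarrow> bool" where
  "is_form d F \<longleftrightarrow> F \<noteq> 0 \<and> (\<forall>i j. coeff (coeff F j) i \<noteq> 0 \<longrightarrow> i + j = d)"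


section \<open>Good primes\<close>

text \<open>
  \<open>splits_with_mults F M\<close>: \<open>F\<close> factors as a nonzero constant times powers of pairwise prime
  linear forms, and \<open>M\<close> is the multiset of the exponents.
\<close>

definition splits_with_mults :: "'a::field bipoly \<Rightarrow> nat multiset \<Rightarrow> bool" where
  "splits_with_mults F M \<longleftrightarrow>
     (\<exists>c ls. c \<noteq> 0 \<and> (\<forall>(l, m) \<in> set ls. is_form 1 l \<and> 0 < m) \<and>
        sorted_wrt (\<lambda>(l, _) (l', _). coprime l l') ls \<and>
        F = const c * (\<Prod>(l, m)\<leftarrow>ls. l ^ m) \<and>
        M = mset (map snd ls))"

text \<open>The prime \<open>p\<close> is \<open>CARD('p)\<close> for a type \<open>'p\<close> of prime cardinality, and \<open>'p mod_ring\<close> is \<open>\<F>\<^sub>p\<close>.\<close>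

definition has_reduction :: "'p::prime_card itself \<Rightarrow> rat bipoly \<Rightarrow> bool" where
  "has_reduction _ G \<longleftrightarrow>
     (\<forall>i j. \<not> int CARD('p) dvd snd (quotient_of (coeff (coeff G j) i)))"

definition rat_mod :: "rat \<Rightarrow> 'p::prime_card mod_ring" where
  "rat_mod q = of_int (fst (quotient_of q)) / of_int (snd (quotient_of q))"

definition reduction :: "rat bipoly \<Rightarrow> 'p::prime_card mod_ring bipoly" where
  "reduction G = map_bipoly rat_mod G"

definition good_prime :: "'p::prime_card itself \<Rightarrow> rat bipoly \<Rightarrow> bool" where
  "good_prime _ G \<longleftrightarrow>
     has_reduction TYPE('p) G \<and>
     (\<exists>M. splits_with_mults (map_bipoly of_rat G :: complex bipoly) M \<and>
          splits_with_mults
            (map_bipoly to_ac (reduction G) :: 'p mod_ring alg_closure bipoly) M)"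


section \<open>The F-pure threshold\<close>

definition in_ideal2 :: "'a::comm_ring_1 bipoly \<Rightarrow> 'a bipoly \<Rightarrow> 'a bipoly \<Rightarrow> bool" where
  "in_ideal2 F a b \<longleftrightarrow> (\<exists>u v. F = u * a + v * b)"

definition fpt :: "'a::field bipoly \<Rightarrow> real" where
  "fpt g = Inf {real a / real (CHAR('a) ^ e) | a e.
                  in_ideal2 (g ^ a) (var_x ^ (CHAR('a) ^ e)) (var_y ^ (CHAR('a) ^ e))}"

definition minimal_denominator :: "real \<Rightarrow> nat \<Rightarrow> bool" where
  "minimal_denominator r n \<longleftrightarrow>
     0 < n \<and> real n * r \<in> \<int> \<and> (\<forall>m>0. real m * r \<in> \<int> \<longrightarrow> n \<le> m)"


section \<open>The log canonical threshold\<close>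

text \<open>
  Every proper birational morphism from a smooth surface onto a neighbourhood of the origin in the
  affine plane that is an isomorphism away from the origin is a composition of finitely many
  blow-ups of points; centres not over the origin do not affect the threshold there. A log
  resolution at the origin is therefore given by its finite set of centres, which are points
  infinitely near to the origin.

  Such a point is a word over the projective line. The empty word is the origin, and \<open>w @ [q]\<close> is
  the point with coordinate \<open>q\<close> on the exceptional curve \<open>E\<^sub>w\<close> of the blow-up of the point \<open>w\<close>
  (\<open>None\<close> being the point at infinity). The blow-up of the origin is covered by the charts
  \<open>(x, y) \<mapsto> (x, x * (y + c))\<close> and \<open>(x, y) \<mapsto> (x * y, x)\<close>; they are centred at the points \<open>Some c\<close>
  and \<open>None\<close> of the exceptional curve, which has the equation \<open>x = 0\<close> in all of them.
\<close>

type_synonym inf_near_point = "complex option list"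

fun blowup_chart :: "complex option \<Rightarrow> complex bipoly \<times> complex bipoly" where
  "blowup_chart (Some c) = (var_x, var_x * (var_y + const c))"
| "blowup_chart None = (var_x * var_y, var_x)"

text \<open>
  \<open>chart_map w\<close> is the map to the plane from the affine chart centred at \<open>w\<close>. The first letter of
  \<open>w\<close> belongs to the first blow-up.
\<close>

fun chart_map :: "inf_near_point \<Rightarrow> complex bipoly \<times> complex bipoly" where
  "chart_map [] = (var_x, var_y)"
| "chart_map (q # w) =
     (subst_xy (fst (blowup_chart q)) (fst (chart_map w)) (snd (chart_map w)),
      subst_xy (snd (blowup_chart q)) (fst (chart_map w)) (snd (chart_map w)))"

definition pull_back :: "inf_near_point \<Rightarrow> complex bipoly \<Rightarrow> complex bipoly" where
  "pull_back w f = subst_xy f (fst (chart_map w)) (snd (chart_map w))"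

definition jacobian :: "complex bipoly \<times> complex bipoly \<Rightarrow> complex bipoly" where
  "jacobian ab = map_poly pderiv (fst ab) * pderiv (snd ab)
                 - pderiv (fst ab) * map_poly pderiv (snd ab)"

text \<open>
  The divisor of \<open>h\<close> has simple normal crossing support at the origin: in the local ring there,
  \<open>h\<close> is a unit times a monomial in a regular system of parameters \<open>s\<close>, \<open>t\<close> (units and parameters
  can be taken to be quotients of polynomials; denominators have been cleared).
\<close>

definition snc_at_origin :: "complex bipoly \<Rightarrow> bool" where
  "snc_at_origin h \<longleftrightarrow>
     (\<exists>s t u v a b. at_origin s = 0 \<and> at_origin t = 0 \<and> at_origin (jacobian (s, t)) \<noteq> 0 \<and>
        at_origin u \<noteq> 0 \<and> at_origin v \<noteq> 0 \<and> u * h = v * s ^ a * t ^ b)"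

definition admissible_centres :: "inf_near_point set \<Rightarrow> bool" where
  "admissible_centres T \<longleftrightarrow> finite T \<and> (\<forall>w q. w @ [q] \<in> T \<longrightarrow> w \<in> T)"

text \<open>The points over the origin of the surface obtained by blowing up the centres in \<open>T\<close>.\<close>

definition points_over_origin :: "inf_near_point set \<Rightarrow> inf_near_point set" where
  "points_over_origin T = {w. w \<notin> T \<and> (w = [] \<or> butlast w \<in> T)}"

text \<open>
  The exceptional divisor is the zero divisor of the Jacobian of the map to the plane, which is
  also the relative canonical divisor.
\<close>

definition log_resolution :: "complex bipoly \<Rightarrow> inf_near_point set \<Rightarrow> bool" where
  "log_resolution f T \<longleftrightarrow> admissible_centres T \<and>
     (\<forall>w \<in> points_over_origin T. snc_at_origin (pull_back w f * jacobian (chart_map w)))"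

text \<open>Orders along \<open>E\<^sub>w\<close>, computed in the chart at its point with coordinate 0.\<close>

definition ord_exc :: "inf_near_point \<Rightarrow> complex bipoly \<Rightarrow> nat" where
  "ord_exc w f = multiplicity var_x (pull_back (w @ [Some 0]) f)"

definition ord_exc_canonical :: "inf_near_point \<Rightarrow> nat" where
  "ord_exc_canonical w = multiplicity var_x (jacobian (chart_map (w @ [Some 0])))"

text \<open>
  The minimum of \<open>(ord\<^sub>E K + 1) / ord\<^sub>E f\<close> over the prime divisors \<open>E\<close> in the total transform of
  \<open>f\<close> whose image contains the origin, where \<open>K\<close> is the relative canonical divisor. They are the
  exceptional curves and the strict transforms of the components of \<open>f\<close> through the origin; for the
  latter, \<open>ord\<^sub>E K = 0\<close>.
\<close>

definition lct_on :: "inf_near_point set \<Rightarrow> complex bipoly \<Rightarrow> real" where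
  "lct_on T f = Min
     ({(real (ord_exc_canonical w) + 1) / real (ord_exc w f) | w. w \<in> T} \<union>
      {1 / real (multiplicity g f) | g. irreducible g \<and> g dvd f \<and> at_origin g = 0})"

text \<open>For \<open>f \<noteq> 0\<close> vanishing at the origin, the value is the same for all log resolutions.\<close>

definition lct :: "complex bipoly \<Rightarrow> real" where
  "lct f = (THE c. \<exists>T. log_resolution f T \<and> c = lct_on T f)"

end

theory Submission
  imports Defs
begin

text \<open>
  Write \<open>G\<close> for the form over \<open>\<complex>\<close> or over the algebraic closure of \<open>\<F>\<^sub>p\<close>. In both cases
  \<open>G = c * l\<^sub>1 ^ m\<^sub>1 * \<dots> * l\<^sub>n ^ m\<^sub>n\<close> with pairwise prime linear forms and the same exponents,
  because \<open>p\<close> is good. Let \<open>D\<close> be the sum of the \<open>m\<^sub>i\<close>.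

  \<^bold>\<open>Characteristic zero.\<close> The log canonical threshold is the minimum of \<open>2 / D\<close> and the
  \<open>1 / m\<^sub>i\<close>. Blowing up the origin is a log resolution with this value. Every other log resolution
  gives the same value because no exceptional curve \<open>E\<close> can do better: two independent
  linear forms satisfy \<open>ord\<^sub>E l + ord\<^sub>E l' \<le> ord\<^sub>E K + 1\<close>, since the Jacobian of their pull-backs is a
  nonzero multiple of the Jacobian of the chart (lemma \<open>orders_of_independent_lines\<close>), and a
  weighted sum of numbers subject to this constraint is largest either when all are equal or when
  all but one vanish (lemma \<open>weighted_order_bound\<close>). The empty set of centres is a log
  resolution only if \<open>n \<le> 2\<close>, and then \<open>2 / D\<close> is at least some \<open>1 / m\<^sub>i\<close>.

  \<^bold>\<open>Characteristic \<open>p\<close>.\<close> For an exponent vector \<open>a\<close> let \<open>l ^ a\<close> be the corresponding product and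
  consider, for \<open>q\<close> a power of \<open>p\<close>, the set of all \<open>a\<close> with \<open>l ^ a \<in> (x ^ q, y ^ q)\<close>. Suppose that
  \<open>l ^ a\<close> and \<open>l ^ b\<close> are both in the ideal and that the componentwise maximum of \<open>a\<close> and \<open>b\<close> has
  total less than \<open>2 * q\<close>. Then the coefficient vectors \<open>(A, B)\<close> and \<open>(A', B')\<close> that express them
  through \<open>x ^ q\<close>, \<open>y ^ q\<close> are proportional: their determinant is divisible by the greatest common
  divisor of \<open>l ^ a\<close> and \<open>l ^ b\<close>, and its degree is too small for that
  (lemma \<open>representations_proportional\<close>). As the Frobenius map raises both \<open>l ^ a\<close> and its
  coefficient vector to the power \<open>p\<close>, a componentwise minimal exponent vector \<open>s\<close> at level \<open>q\<close> stays
  a lower bound at every level \<open>p ^ e * q\<close>, for the \<open>b\<close> whose maximum with \<open>p ^ e * s\<close> has total less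
  than \<open>2 * p ^ e * q\<close>: if such a \<open>b\<close> were smaller than \<open>p ^ e * s\<close> in the place \<open>i\<close>, then \<open>l\<^sub>i\<close> would
  divide the coefficient vector of \<open>l ^ s\<close> and could be cancelled (lemma \<open>minimal_in_frob_dominates\<close>).
  So if the F-pure threshold is below \<open>2 / D\<close>, it is the maximum
  of the numbers \<open>s\<^sub>i / (m\<^sub>i * q)\<close> for one fixed \<open>s\<close> and \<open>q\<close>, in particular equal to one of them.

  \<^bold>\<open>Conclusion.\<close> The F-pure threshold \<open>r\<close> is at most \<open>2 / D\<close> and at most every \<open>1 / m\<^sub>i\<close>, so it is at
  most the log canonical threshold. If the two differ, then \<open>r < 2 / D\<close> and \<open>0 < r * m\<^sub>i < 1\<close> for all
  \<open>i\<close>, while \<open>r * m\<^sub>i * p ^ e\<close> is an integer for some \<open>i\<close> and \<open>e\<close>. As \<open>r * m\<^sub>i\<close> is not an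
  integer, \<open>p\<close> divides the denominator of \<open>r\<close>, and what remains after splitting off the power of \<open>p\<close>
  divides \<open>m\<^sub>i\<close>.
\<close>

section \<open>Linear forms\<close>

definition lin :: "'a::comm_ring_1 \<Rightarrow> 'a \<Rightarrow> 'a bipoly" where
  "lin \<alpha> \<beta> = [:[:0, \<alpha>:], [:\<beta>:]:]"

lemma bipoly_eqI:
  fixes F G :: "'a::zero poly poly"
  assumes "\<And>i j. coeff (coeff F j) i = coeff (coeff G j) i"
  shows "F = G"
  using assms by (intro poly_eqI) blast

lemma lin_conv_vars: "lin \<alpha> \<beta> = const \<alpha> * var_x + const \<beta> * var_y"
  by (simp add: lin_def const_def var_x_def var_y_def)

lemma var_x_conv_lin: "var_x = lin 1 0"
  by (simp add: lin_def var_x_def one_pCons)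

lemma lin_eq_0_iff [simp]: "lin \<alpha> \<beta> = 0 \<longleftrightarrow> \<alpha> = 0 \<and> \<beta> = 0"
  by (simp add: lin_def)

lemma const_eq_0_iff [simp]: "const c = 0 \<longleftrightarrow> c = 0"
  by (simp add: const_def)

lemma const_mult: "const (a * b) = const a * const b"
  by (simp add: const_def)

lemma is_unit_const: "c \<noteq> 0 \<Longrightarrow> is_unit (const (c :: 'a::field))"
  by (simp add: const_def is_unit_const_poly_iff)

lemma form_one_conv_lin:
  assumes "is_form 1 l"
  obtains \<alpha> \<beta> where "l = lin \<alpha> \<beta>" "\<alpha> \<noteq> 0 \<or> \<beta> \<noteq> 0"
proof -
  have *: "l = lin (coeff (coeff l 0) 1) (coeff (coeff l 1) 0)"
  proof (rule bipoly_eqI)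
    fix i j
    show "coeff (coeff l j) i
        = coeff (coeff (lin (coeff (coeff l 0) 1) (coeff (coeff l 1) 0)) j) i"
    proof (cases "i + j = 1")
      case True
      then have "i = 0 \<and> j = 1 \<or> i = 1 \<and> j = 0" by auto
      then show ?thesis by (auto simp: lin_def)
    next
      case False
      then have "coeff (coeff l j) i = 0" using assms by (auto simp: is_form_def)
      with False show ?thesis
        by (auto simp: lin_def coeff_pCons split: nat.splits)
    qed
  qed
  with assms show ?thesis by (metis is_form_def lin_eq_0_iff that)
qed

lemma at_origin_lin [simp]: "at_origin (lin \<alpha> \<beta>) = 0"
  by (simp add: at_origin_def lin_def)

lemma at_origin_mult [simp]: "at_origin (F * G) = at_origin F * at_origin G"
  by (simp add: at_origin_def coeff_mult_0)

lemma at_origin_1 [simp]: "at_origin 1 = 1"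
  by (simp add: at_origin_def)

lemma at_origin_const [simp]: "at_origin (const c) = c"
  by (simp add: at_origin_def const_def)

lemma lin_not_unit: "\<not> is_unit (lin \<alpha> (\<beta> :: 'a::field))"
proof
  assume "is_unit (lin \<alpha> \<beta>)"
  then obtain h where "1 = lin \<alpha> \<beta> * h" by (auto elim: dvdE)
  then have "at_origin 1 = at_origin (lin \<alpha> \<beta> * h)" by simp
  then show False by simp
qed

lemma prime_elem_linear_over_idom: "prime_elem [:c, 1 :: 'a::idom_divide:]"
proof (rule prime_elemI)
  show "\<not> is_unit [:c, 1:]"
    by (auto simp: is_unit_poly_iff)
qed (auto simp: dvd_iff_poly_eq_0)

text \<open>
  A linear form is, up to a unit, either a polynomial in \<open>x\<close> alone or monic of degree one in \<open>y\<close>; in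
  the second case the factor theorem over \<open>k[x]\<close> applies.
\<close>

lemma prime_elem_lin:
  fixes \<alpha> \<beta> :: "'a::field"
  assumes "\<alpha> \<noteq> 0 \<or> \<beta> \<noteq> 0"
  shows "prime_elem (lin \<alpha> \<beta>)"
proof (cases "\<beta> = 0")
  case True
  then have "lin \<alpha> \<beta> = [:[:0, \<alpha>:]:]" by (simp add: lin_def)
  moreover have "prime_elem [:0, \<alpha>:]"
    using assms True by (intro prime_elem_linear_field_poly) auto
  ultimately show ?thesis by (metis lift_prime_elem_poly)
next
  case False
  then have "lin \<alpha> \<beta> = const \<beta> * [:[:0, \<alpha> / \<beta>:], 1:]"
    by (simp add: lin_def const_def)
  moreover have "is_unit (const \<beta>)"
    using False by (rule is_unit_const)
  ultimately show ?thesis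
    using prime_elem_linear_over_idom[of "[:0, \<alpha> / \<beta>:]"]
    by (metis prime_elem_mult_unit_left)
qed

lemma coprime_lin_imp_det_nonzero:
  fixes \<alpha> \<beta> \<gamma> \<delta> :: "'a::field"
  assumes "coprime (lin \<alpha> \<beta>) (lin \<gamma> \<delta>)"
  shows "\<alpha> * \<delta> - \<beta> * \<gamma> \<noteq> 0"
proof
  assume det: "\<alpha> * \<delta> - \<beta> * \<gamma> = 0"
  have "lin \<alpha> \<beta> dvd lin \<gamma> \<delta> \<or> lin \<gamma> \<delta> dvd lin \<alpha> \<beta>"
  proof (cases "\<alpha> = 0")
    case False
    then have "\<delta> = \<gamma> / \<alpha> * \<beta>"
      using det by (simp add: field_simps)
    with False have "lin \<gamma> \<delta> = const (\<gamma> / \<alpha>) * lin \<alpha> \<beta>"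
      by (simp add: lin_def const_def)
    then show ?thesis by (simp only: dvd_triv_right simp_thms)
  next
    case True
    show ?thesis
    proof (cases "\<beta> = 0")
      case True
      with \<open>\<alpha> = 0\<close> have "lin \<alpha> \<beta> = 0" by simp
      then show ?thesis by (simp only: dvd_0_right simp_thms)
    next
      case False
      with True det have "lin \<gamma> \<delta> = const (\<delta> / \<beta>) * lin \<alpha> \<beta>"
        by (simp add: lin_def const_def)
      then show ?thesis by (simp only: dvd_triv_right simp_thms)
    qed
  qed
  then show False
    using coprime_common_divisor[OF assms dvd_refl] coprime_common_divisor[OF assms _ dvd_refl]
      lin_not_unit by blast
qed


lemma independent_vector_exists:
  fixes \<alpha> \<beta> :: "'a::field"
  assumes "\<alpha> \<noteq> 0 \<or> \<beta> \<noteq> 0"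
  obtains \<gamma> \<delta> where "\<alpha> * \<delta> - \<beta> * \<gamma> \<noteq> 0"
proof (cases "\<alpha> = 0")
  case True
  then show ?thesis using assms that[of 0 1] by simp
next
  case False
  then show ?thesis using that[of 1 0] by simp
qed

lemma prime_elem_dvd_prodE:
  assumes "finite A" "prime_elem p" "p dvd prod f A"
  obtains x where "x \<in> A" "p dvd f x"
proof -
  have "\<exists>x\<in>A. p dvd f x"
    using assms
    by (induction A rule: finite_induct) (auto simp: prime_elem_dvd_mult_iff dest: prime_elem_not_unit)
  with that show ?thesis by blast
qed


section \<open>Orders and degrees\<close>

text \<open>
  Membership in the power \<open>(x, y) ^ k\<close>. A nonzero polynomial cannot have an order that exceeds its
  degree. With this remark a product of linear forms can be compared with its multiples without
  splitting anything into homogeneous components.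
\<close>

definition vanishes_to :: "nat \<Rightarrow> 'a::comm_ring_1 bipoly \<Rightarrow> bool" where
  "vanishes_to k F \<longleftrightarrow> (\<forall>i j. i + j < k \<longrightarrow> coeff (coeff F j) i = 0)"

definition total_degree_le :: "nat \<Rightarrow> 'a::comm_ring_1 bipoly \<Rightarrow> bool" where
  "total_degree_le k F \<longleftrightarrow> (\<forall>i j. coeff (coeff F j) i \<noteq> 0 \<longrightarrow> i + j \<le> k)"

lemma coeff_bipoly_mult:
  "coeff (coeff (F * G) j) i
     = (\<Sum>b\<le>j. \<Sum>a\<le>i. coeff (coeff F b) a * coeff (coeff G (j - b)) (i - a))"
  by (simp add: coeff_mult coeff_sum)

lemma vanishes_to_mult:
  assumes "vanishes_to k F" "vanishes_to l G"
  shows "vanishes_to (k + l) (F * G)"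
  unfolding vanishes_to_def
proof (intro allI impI)
  fix i j assume ij: "i + j < k + l"
  have "coeff (coeff F b) a * coeff (coeff G (j - b)) (i - a) = 0" if "b \<le> j" "a \<le> i" for a b
  proof (cases "a + b < k")
    case False
    then have "(i - a) + (j - b) < l" using ij that by linarith
    then show ?thesis using assms by (simp add: vanishes_to_def)
  qed (use assms in \<open>simp add: vanishes_to_def\<close>)
  then show "coeff (coeff (F * G) j) i = 0"
    by (simp add: coeff_bipoly_mult)
qed

lemma total_degree_le_mult:
  assumes "total_degree_le k F" "total_degree_le l G"
  shows "total_degree_le (k + l) (F * G)"
  unfolding total_degree_le_def
proof (intro allI impI)
  fix i j assume nz: "coeff (coeff (F * G) j) i \<noteq> 0"
  have "\<exists>b\<le>j. \<exists>a\<le>i. coeff (coeff F b) a * coeff (coeff G (j - b)) (i - a) \<noteq> 0"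
  proof (rule ccontr)
    assume "\<not> ?thesis"
    then have "coeff (coeff (F * G) j) i = 0"
      unfolding coeff_bipoly_mult by (intro sum.neutral ballI) auto
    with nz show False by simp
  qed
  then obtain a b where ab: "b \<le> j" "a \<le> i"
    "coeff (coeff F b) a \<noteq> 0" "coeff (coeff G (j - b)) (i - a) \<noteq> 0"
    by force
  then have "a + b \<le> k" "(i - a) + (j - b) \<le> l"
    using assms unfolding total_degree_le_def by blast+
  with ab show "i + j \<le> k + l" by linarith
qed

lemma vanishes_to_0: "vanishes_to 0 F"
  by (simp add: vanishes_to_def)

lemma total_degree_le_const: "total_degree_le 0 (const c)"
  by (auto simp: total_degree_le_def const_def coeff_pCons split: nat.splits)

lemma total_degree_le_1: "total_degree_le 0 1"
  using total_degree_le_const[of 1] by (simp add: const_def one_pCons)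

lemma total_degree_le_diff:
  "total_degree_le k F \<Longrightarrow> total_degree_le k G \<Longrightarrow> total_degree_le k (F - G)"
  unfolding total_degree_le_def by (metis coeff_diff diff_zero)

lemma vanishes_to_power: "vanishes_to k F \<Longrightarrow> vanishes_to (n * k) (F ^ n)"
  by (induction n) (auto simp: vanishes_to_0 intro: vanishes_to_mult)

lemma total_degree_le_power: "total_degree_le k F \<Longrightarrow> total_degree_le (n * k) (F ^ n)"
  by (induction n) (auto simp: total_degree_le_1 intro: total_degree_le_mult)

lemma vanishes_to_prod:
  "finite I \<Longrightarrow> (\<And>i. i \<in> I \<Longrightarrow> vanishes_to (k i) (F i)) \<Longrightarrow> vanishes_to (sum k I) (prod F I)"
  by (induction I rule: finite_induct) (auto simp: vanishes_to_0 intro: vanishes_to_mult)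

lemma total_degree_le_prod:
  "finite I \<Longrightarrow> (\<And>i. i \<in> I \<Longrightarrow> total_degree_le (k i) (F i)) \<Longrightarrow> total_degree_le (sum k I) (prod F I)"
  by (induction I rule: finite_induct) (auto simp: total_degree_le_1 intro: total_degree_le_mult)

lemma eq_0_if_degree_less_order:
  assumes "total_degree_le d F" "vanishes_to k F" "d < k"
  shows "F = 0"
proof (rule bipoly_eqI)
  show "coeff (coeff F j) i = coeff (coeff 0 j) i" for i j
    using assms unfolding total_degree_le_def vanishes_to_def
    by (metis coeff_0 order.strict_trans1)
qed

lemma vanishes_to_lin: "vanishes_to 1 (lin \<alpha> \<beta>)"
  by (auto simp: vanishes_to_def lin_def)

lemma total_degree_le_lin: "total_degree_le 1 (lin \<alpha> \<beta>)"
  by (auto simp: total_degree_le_def lin_def coeff_pCons split: nat.splits)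


section \<open>Membership in \<open>(x^q, y^q)\<close>\<close>

lemma var_y_power: "var_y ^ q = monom 1 q"
  by (simp add: var_y_def x_as_monom[symmetric] monom_altdef)

lemma var_x_power: "var_x ^ q = [:monom 1 q:]"
proof -
  have "var_x ^ q = [:[:0, 1:] ^ q:]" by (simp add: var_x_def poly_const_pow)
  then show ?thesis by (simp add: monom_altdef)
qed

lemma coeff_mult_var_y_power: "coeff (F * var_y ^ q) j = (if q \<le> j then coeff F (j - q) else 0)"
  by (simp add: var_y_power mult.commute[of F] coeff_monom_mult)

lemma coeff_mult_var_x_power:
  "coeff (coeff (F * var_x ^ q) j) i = (if q \<le> i then coeff (coeff F j) (i - q) else 0)"
  by (simp add: var_x_power mult.commute[of F] coeff_monom_mult)

text \<open>
  The ideal is generated by monomials, so membership can be read off the coefficients, and the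
  multipliers can be taken to be pieces of \<open>F\<close>, shifted by \<open>q\<close>. This makes membership insensitive to
  field extensions and keeps the degrees of the multipliers under control.
\<close>

lemma in_ideal2_powers_iff:
  "in_ideal2 F (var_x ^ q) (var_y ^ q) \<longleftrightarrow> (\<forall>i<q. \<forall>j<q. coeff (coeff F j) i = 0)"
  (is "?L \<longleftrightarrow> ?R")
  and in_ideal2_powers_degree:
  "in_ideal2 F (var_x ^ q) (var_y ^ q) \<Longrightarrow> total_degree_le N F \<Longrightarrow>
     \<exists>A B. F = A * var_x ^ q + B * var_y ^ q \<and> total_degree_le (N - q) A \<and> total_degree_le (N - q) B"
proof -
  define A where "A = map_poly (poly_shift q) F"
  define B where "B = poly_shift q (map_poly (poly_cutoff q) F)"
  have cA: "coeff (coeff A j) i = coeff (coeff F j) (i + q)" for i j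
    by (simp add: A_def coeff_map_poly coeff_poly_shift)
  have cB: "coeff (coeff B j) i = (if i < q then coeff (coeff F (j + q)) i else 0)" for i j
    by (simp add: B_def coeff_map_poly coeff_poly_shift coeff_poly_cutoff)
  have LR: "?L \<Longrightarrow> ?R"
    by (auto simp: in_ideal2_def coeff_mult_var_x_power coeff_mult_var_y_power)
  have F: "F = A * var_x ^ q + B * var_y ^ q" if ?R
    using that by (intro bipoly_eqI) (auto simp: coeff_mult_var_x_power coeff_mult_var_y_power cA cB)
  show "?L \<longleftrightarrow> ?R" using LR F by (auto simp: in_ideal2_def)
  assume L: ?L and N: "total_degree_le N F"
  have "total_degree_le (N - q) A"
    unfolding total_degree_le_def cA using N unfolding total_degree_le_def by fastforce
  moreover have "total_degree_le (N - q) B"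
    unfolding total_degree_le_def cB
  proof (intro allI impI)
    fix i j assume "(if i < q then coeff (coeff F (j + q)) i else 0) \<noteq> 0"
    then have "i + (j + q) \<le> N"
      using N unfolding total_degree_le_def by (metis (full_types))
    then show "i + j \<le> N - q" by simp
  qed
  ultimately show "\<exists>A B. F = A * var_x ^ q + B * var_y ^ q \<and> total_degree_le (N - q) A
                       \<and> total_degree_le (N - q) B"
    using F LR L by blast
qed

section \<open>Products of linear forms and Frobenius powers of the maximal ideal\<close>

text \<open>
  When \<open>q\<close> is a power of the characteristic, this is the Frobenius power of the maximal ideal
  \<open>(x, y)\<close>.
\<close>

abbreviation in_frob :: "nat \<Rightarrow> 'a::comm_ring_1 bipoly \<Rightarrow> bool" where
  "in_frob q F \<equiv> in_ideal2 F (var_x ^ q) (var_y ^ q)"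

lemma in_frob_mult: "in_frob q F \<Longrightarrow> in_frob q (F * G)"
proof -
  assume "in_frob q F"
  then obtain u v where "F = u * var_x ^ q + v * var_y ^ q"
    by (auto simp: in_ideal2_def)
  then have "F * G = (u * G) * var_x ^ q + (v * G) * var_y ^ q"
    by (simp add: algebra_simps)
  then show ?thesis unfolding in_ideal2_def by blast
qed

lemma in_frob_power:
  fixes F :: "'a::field bipoly"
  assumes "prime CHAR('a)" "q' = CHAR('a) ^ e" "in_frob q F"
  shows "in_frob (q * q') (F ^ q')"
proof -
  obtain u v where "F = u * var_x ^ q + v * var_y ^ q"
    using assms(3) by (auto simp: in_ideal2_def)
  then have "F ^ q' = u ^ q' * var_x ^ (q * q') + v ^ q' * var_y ^ (q * q')"
    using assms(1,2) by (simp add: freshmans_dream' power_mult_distrib flip: power_mult)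
  then show ?thesis by (auto simp: in_ideal2_def)
qed

lemma in_frob_lin_power:
  fixes \<alpha> \<beta> :: "'a::field"
  assumes "prime CHAR('a)" "q = CHAR('a) ^ e"
  shows "in_frob q (lin \<alpha> \<beta> ^ q)"
proof -
  have "in_frob 1 (lin \<alpha> \<beta>)"
    by (auto simp: in_ideal2_def lin_conv_vars)
  from in_frob_power[OF assms this] show ?thesis by simp
qed

text \<open>
  Pairwise prime linear forms are the equations of distinct points of the projective line. Monomials in the \<open>L i\<close> are written \<open>mon a\<close> for an exponent
  vector \<open>a\<close>, of which only the first \<open>n\<close> entries count.
\<close>

locale coprime_linear_forms =
  fixes L :: "nat \<Rightarrow> 'a::field bipoly" and n :: nat
  assumes form: "i < n \<Longrightarrow> is_form 1 (L i)"
    and cop: "i < n \<Longrightarrow> j < n \<Longrightarrow> i \<noteq> j \<Longrightarrow> coprime (L i) (L j)"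
begin

definition mon :: "(nat \<Rightarrow> nat) \<Rightarrow> 'a bipoly" where
  "mon a = (\<Prod>i<n. L i ^ a i)"

definition deg :: "(nat \<Rightarrow> nat) \<Rightarrow> nat" where
  "deg a = (\<Sum>i<n. a i)"

lemma prime_L: "i < n \<Longrightarrow> prime_elem (L i)"
  using form form_one_conv_lin prime_elem_lin by metis

lemma L_nonzero: "i < n \<Longrightarrow> L i \<noteq> 0"
  using prime_L[of i] prime_elem_not_zeroI by auto

lemma mon_nonzero [simp]: "mon a \<noteq> 0"
  using L_nonzero by (auto simp: mon_def)

lemma mon_add: "mon (\<lambda>i. a i + b i) = mon a * mon b"
  by (simp add: mon_def power_add prod.distrib)

lemma mon_power: "mon a ^ k = mon (\<lambda>i. k * a i)"
  by (simp add: mon_def prod_power_distrib mult.commute flip: power_mult)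

lemma mon_cong: "(\<And>i. i < n \<Longrightarrow> a i = b i) \<Longrightarrow> mon a = mon b"
  by (simp add: mon_def)

lemma mon_le: "(\<And>i. i < n \<Longrightarrow> a i \<le> b i) \<Longrightarrow> mon b = mon a * mon (\<lambda>i. b i - a i)"
  by (subst mon_add[symmetric], rule mon_cong) simp

lemma mon_split: "i < n \<Longrightarrow> mon a = L i ^ a i * mon (a(i := 0))"
  by (simp add: mon_def prod.remove[of "{..<n}" i])

lemma not_L_dvd_mon:
  assumes "i < n" "a i = 0"
  shows "\<not> L i dvd mon a"
proof
  assume "L i dvd mon a"
  then obtain j where "j \<in> {..<n}" and j: "L i dvd L j ^ a j"
    unfolding mon_def by (rule prime_elem_dvd_prodE[OF finite_lessThan prime_L[OF assms(1)]])
  then have "j < n" by simp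
  with j have "L i dvd L j" using prime_L[OF assms(1)] prime_elem_dvd_power by blast
  moreover have "i \<noteq> j" using j assms(2) prime_elem_not_unit[OF prime_L[OF assms(1)]] by auto
  ultimately have "is_unit (L i)"
    using coprime_common_divisor[OF cop[OF assms(1) \<open>j < n\<close>]] by simp
  then show False using prime_elem_not_unit[OF prime_L[OF assms(1)]] by simp
qed

lemma vanishes_to_mon: "vanishes_to (deg a) (mon a)"
proof -
  have "vanishes_to (a i) (L i ^ a i)" if "i < n" for i
    using vanishes_to_power[of 1 "L i" "a i"] form_one_conv_lin[OF form[OF that]] vanishes_to_lin
    by (metis mult.right_neutral)
  then show ?thesis unfolding mon_def deg_def by (intro vanishes_to_prod) auto
qed

lemma total_degree_le_mon: "total_degree_le (deg a) (mon a)"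
proof -
  have "total_degree_le (a i) (L i ^ a i)" if "i < n" for i
    using total_degree_le_power[of 1 "L i" "a i"] form_one_conv_lin[OF form[OF that]] total_degree_le_lin
    by (metis mult.right_neutral)
  then show ?thesis unfolding mon_def deg_def by (intro total_degree_le_prod) auto
qed

lemma deg_ge_if_in_frob:
  assumes "in_frob q (mon a)"
  shows "q \<le> deg a"
proof (rule ccontr)
  assume "\<not> q \<le> deg a"
  moreover have "vanishes_to q (mon a)"
    using assms by (auto simp: in_ideal2_powers_iff vanishes_to_def)
  ultimately show False
    using eq_0_if_degree_less_order[OF total_degree_le_mon, of q a] by simp
qed

lemma in_frob_if_deg_ge:
  assumes "2 * q \<le> deg a"
  shows "in_frob q (mon a)"
  using assms vanishes_to_mon[of a] by (auto simp: in_ideal2_powers_iff vanishes_to_def)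

lemma in_frob_mono:
  assumes "in_frob q (mon a)" "\<And>i. i < n \<Longrightarrow> a i \<le> b i"
  shows "in_frob q (mon b)"
  using in_frob_mult[OF assms(1)] mon_le[of a b] assms(2) by simp

text \<open>
  The determinant \<open>D = A' * B - A * B'\<close> of the two coefficient vectors becomes a combination of
  \<open>mon a\<close> and \<open>mon b\<close> after multiplication by \<open>y ^ q\<close>, and likewise for \<open>x ^ q\<close>. So both \<open>x ^ q * D\<close> and
  \<open>y ^ q * D\<close> are multiples of the greatest common divisor of \<open>mon a\<close> and \<open>mon b\<close>, and hence so is \<open>D\<close>.
  Its degree is less than that of the divisor, which forces \<open>D = 0\<close>.
\<close>

lemma representations_proportional:
  assumes a: "mon a = A * var_x ^ q + B * var_y ^ q"
    and b: "mon b = A' * var_x ^ q + B' * var_y ^ q"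
    and deg: "total_degree_le k A" "total_degree_le k B"
      "total_degree_le k' A'" "total_degree_le k' B'"
    and less: "k + k' < deg (\<lambda>i. min (a i) (b i))"
  shows "A' * mon a = A * mon b" "B' * mon a = B * mon b"
proof -
  define D where "D = A' * B - A * B'"
  define P where "P = mon (\<lambda>i. min (a i) (b i))"
  define u where "u = mon (\<lambda>i. a i - min (a i) (b i))"
  define v where "v = mon (\<lambda>i. b i - min (a i) (b i))"
  define E\<^sub>y where "E\<^sub>y = A' * u - A * v"
  define E\<^sub>x where "E\<^sub>x = B * v - B' * u"
  have Pu: "mon a = P * u" and Pv: "mon b = P * v"
    by (simp_all add: P_def u_def v_def mon_le[symmetric])
  have Dy: "var_y ^ q * D = P * E\<^sub>y"
  proof -
    have "var_y ^ q * D = A' * mon a - A * mon b" unfolding a b D_def by (simp add: algebra_simps)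
    also have "\<dots> = P * E\<^sub>y" unfolding Pu Pv E\<^sub>y_def by (simp add: algebra_simps)
    finally show ?thesis .
  qed
  have Dx: "var_x ^ q * D = P * E\<^sub>x"
  proof -
    have "var_x ^ q * D = B * mon b - B' * mon a" unfolding a b D_def by (simp add: algebra_simps)
    also have "\<dots> = P * E\<^sub>x" unfolding Pu Pv E\<^sub>x_def by (simp add: algebra_simps)
    finally show ?thesis .
  qed
  have "P * (E\<^sub>y * var_x ^ q) = var_y ^ q * D * var_x ^ q"
    unfolding Dy by (simp only: mult.assoc)
  also have "\<dots> = var_x ^ q * D * var_y ^ q"
    by (simp only: mult_ac)
  also have "\<dots> = P * (E\<^sub>x * var_y ^ q)"
    unfolding Dx by (simp only: mult.assoc)
  finally have "P * (E\<^sub>y * var_x ^ q) = P * (E\<^sub>x * var_y ^ q)" .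
  then have E: "E\<^sub>y * var_x ^ q = E\<^sub>x * var_y ^ q"
    by (simp add: P_def)
  \<comment> \<open>\<open>x ^ q\<close> and \<open>y ^ q\<close> are coprime, so \<open>y ^ q\<close> divides \<open>E\<^sub>y\<close>.\<close>
  have "coeff E\<^sub>y j = 0" if "j < q" for j
  proof (rule poly_eqI)
    fix i
    have "coeff (coeff E\<^sub>y j) i = coeff (coeff (E\<^sub>y * var_x ^ q) j) (i + q)"
      by (simp add: coeff_mult_var_x_power)
    also have "\<dots> = 0" unfolding E using that by (simp add: coeff_mult_var_y_power)
    finally show "coeff (coeff E\<^sub>y j) i = coeff 0 i" by simp
  qed
  then have "var_y ^ q dvd E\<^sub>y" by (simp add: var_y_power monom_1_dvd_iff')
  then obtain E' where "E\<^sub>y = var_y ^ q * E'" ..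
  with Dy have "var_y ^ q * D = var_y ^ q * (P * E')" by (simp add: mult_ac)
  then have "D = P * E'"
    by (simp add: var_y_power)
  then have "vanishes_to (deg (\<lambda>i. min (a i) (b i))) D"
    using vanishes_to_mult[OF vanishes_to_mon vanishes_to_0] by (simp add: P_def)
  moreover have "total_degree_le (k + k') D"
    unfolding D_def
    using total_degree_le_mult[OF deg(3) deg(2)] total_degree_le_mult[OF deg(1) deg(4)]
    by (intro total_degree_le_diff) (simp_all add: add.commute)
  ultimately have "D = 0" using less by (intro eq_0_if_degree_less_order)
  then have "A' * B = A * B'" by (simp add: D_def)
  then show "A' * mon a = A * mon b" "B' * mon a = B * mon b"
    unfolding a b by (simp_all add: algebra_simps)
qed

definition minimal_in_frob :: "nat \<Rightarrow> (nat \<Rightarrow> nat) \<Rightarrow> bool" where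
  "minimal_in_frob q s \<longleftrightarrow> in_frob q (mon s) \<and>
     (\<forall>i<n. 0 < s i \<longrightarrow> \<not> in_frob q (mon (s(i := s i - 1))))"

lemma minimal_in_frob_exists:
  assumes "in_frob q (mon t)"
  obtains s where "minimal_in_frob q s" "\<And>i. i < n \<Longrightarrow> s i \<le> t i"
proof -
  obtain s where s: "in_frob q (mon s)" "\<forall>i<n. s i \<le> t i"
    and least: "\<And>s'. in_frob q (mon s') \<and> (\<forall>i<n. s' i \<le> t i) \<Longrightarrow> deg s \<le> deg s'"
    using ex_has_least_nat[of "\<lambda>s. in_frob q (mon s) \<and> (\<forall>i<n. s i \<le> t i)" t deg] assms by auto
  have "\<not> in_frob q (mon (s(i := s i - 1)))" if i: "i < n" "0 < s i" for i
  proof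
    assume *: "in_frob q (mon (s(i := s i - 1)))"
    have "\<forall>j<n. (s(i := s i - 1)) j \<le> t j" using s by fastforce
    with * have "deg s \<le> deg (s(i := s i - 1))" using least by blast
    moreover have "deg (s(i := s i - 1)) < deg s"
      unfolding deg_def using i by (intro sum_strict_mono_ex1) auto
    ultimately show False by simp
  qed
  with s that show ?thesis by (auto simp: minimal_in_frob_def)
qed

text \<open>
  A minimal exponent vector \<open>s\<close> at level \<open>q\<close> remains a lower bound at the level \<open>q * q'\<close>, in the range
  where the proportionality of coefficient vectors applies. Frobenius gives the representation
  of \<open>mon (q' * s)\<close> with coefficients \<open>A ^ q'\<close>, \<open>B ^ q'\<close>. If \<open>b i < q' * s i\<close>, then comparison with
  \<open>mon b\<close> shows that \<open>L i\<close> divides these coefficients, hence \<open>A\<close> and \<open>B\<close>, and cancelling it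
  contradicts the minimality of \<open>s\<close>.
\<close>

lemma minimal_in_frob_dominates:
  assumes char: "prime CHAR('a)" and q': "q' = CHAR('a) ^ e"
    and s: "minimal_in_frob q s" and st: "\<And>i. i < n \<Longrightarrow> s i \<le> t i"
    and t: "deg t < 2 * q"
    and b: "in_frob (q * q') (mon b)" and bt: "\<And>i. i < n \<Longrightarrow> b i \<le> q' * t i"
    and i: "i < n"
  shows "q' * s i \<le> b i"
proof (rule ccontr)
  assume "\<not> q' * s i \<le> b i"
  then have less: "b i < q' * s i" by simp
  have q'0: "0 < q'" using char q' by (simp add: prime_gt_0_nat)
  obtain A B where AB: "mon s = A * var_x ^ q + B * var_y ^ q"
    "total_degree_le (deg s - q) A" "total_degree_le (deg s - q) B"
    using in_ideal2_powers_degree[OF _ total_degree_le_mon] s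
    unfolding minimal_in_frob_def by blast
  obtain A' B' where AB': "mon b = A' * var_x ^ (q * q') + B' * var_y ^ (q * q')"
    "total_degree_le (deg b - q * q') A'" "total_degree_le (deg b - q * q') B'"
    using in_ideal2_powers_degree[OF b total_degree_le_mon] by blast
  define a where "a = (\<lambda>i. q' * s i)"
  have a: "mon a = A ^ q' * var_x ^ (q * q') + B ^ q' * var_y ^ (q * q')"
    unfolding a_def mon_power[symmetric] AB(1) using char q'
    by (simp add: freshmans_dream' power_mult_distrib flip: power_mult)
  \<comment> \<open>The degree bound of the proportionality lemma is the bound \<open>2 * q * q'\<close> on the degree of the
    maximum, because maximum and minimum of \<open>a\<close> and \<open>b\<close> add up to \<open>a + b\<close>.\<close>
  have deg_sum: "deg a + deg b = deg (\<lambda>i. max (a i) (b i)) + deg (\<lambda>i. min (a i) (b i))"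
    unfolding deg_def sum.distrib[symmetric] by (intro sum.cong) auto
  have "deg (\<lambda>i. max (a i) (b i)) \<le> q' * deg t"
    unfolding deg_def sum_distrib_left a_def using st bt by (intro sum_mono) auto
  also have "\<dots> < q' * (2 * q)" using t q'0 by simp
  finally have max: "deg (\<lambda>i. max (a i) (b i)) < 2 * (q * q')" by (simp add: mult_ac)
  have da: "deg a = q' * deg s" by (simp add: a_def deg_def sum_distrib_left)
  have "q \<le> deg s" using deg_ge_if_in_frob s by (auto simp: minimal_in_frob_def)
  then have "q' * (deg s - q) = deg a - q * q'" "q * q' \<le> deg a"
    by (simp_all add: da diff_mult_distrib2 mult.commute)
  moreover have "q * q' \<le> deg b" using deg_ge_if_in_frob b by blast
  ultimately have less_min:
    "q' * (deg s - q) + (deg b - q * q') < deg (\<lambda>i. min (a i) (b i))"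
    using deg_sum max by linarith
  note proportional = representations_proportional[OF a AB'(1) total_degree_le_power[OF AB(2)]
      total_degree_le_power[OF AB(3)] AB'(2) AB'(3) less_min]
  have L_dvd: "L i dvd C" if "C' * mon a = C ^ q' * mon b" for C C'
  proof -
    have "mon a = L i ^ b i * (L i ^ (a i - b i) * mon (a(i := 0)))"
      using mon_split[OF i, of a] less unfolding a_def
      by (simp add: mult.assoc[symmetric] power_add[symmetric])
    with that have "L i ^ b i * (C' * (L i ^ (a i - b i) * mon (a(i := 0))))
        = L i ^ b i * (C ^ q' * mon (b(i := 0)))"
      using mon_split[OF i, of b] by (simp add: mult_ac)
    then have "C' * (L i ^ (a i - b i) * mon (a(i := 0))) = C ^ q' * mon (b(i := 0))"
      using L_nonzero[OF i] by simp
    moreover have "L i dvd L i ^ (a i - b i)"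
      using less by (intro dvd_power) (auto simp: a_def)
    ultimately have "L i dvd C ^ q' * mon (b(i := 0))"
      by (metis dvd_mult dvd_mult2)
    then have "L i dvd C ^ q'"
      using prime_L[OF i] not_L_dvd_mon[OF i, of "b(i := 0)"] by (simp add: prime_elem_dvd_mult_iff)
    then show ?thesis using prime_L[OF i] prime_elem_dvd_power by blast
  qed
  obtain A\<^sub>1 where A\<^sub>1: "A = L i * A\<^sub>1" using L_dvd[OF proportional(1)] ..
  obtain B\<^sub>1 where B\<^sub>1: "B = L i * B\<^sub>1" using L_dvd[OF proportional(2)] ..
  have si: "0 < s i" using less by (cases "s i") auto
  have "mon s = L i * mon (s(i := s i - 1))"
    using mon_split[OF i, of s] mon_split[OF i, of "s(i := s i - 1)"] si
    by (simp add: mult.assoc[symmetric] power_eq_if)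
  with AB(1) A\<^sub>1 B\<^sub>1 have "L i * mon (s(i := s i - 1)) = L i * (A\<^sub>1 * var_x ^ q + B\<^sub>1 * var_y ^ q)"
    by (simp add: algebra_simps)
  then have "mon (s(i := s i - 1)) = A\<^sub>1 * var_x ^ q + B\<^sub>1 * var_y ^ q"
    using L_nonzero[OF i] by simp
  then have "in_frob q (mon (s(i := s i - 1)))" by (auto simp: in_ideal2_def)
  with s i si show False by (auto simp: minimal_in_frob_def)
qed

end

section \<open>The F-pure threshold of a product of linear forms\<close>

text \<open>
  The fractions with denominator a power of \<open>p\<close> are dense. Restricting to denominators beyond
  \<open>p ^ e\<^sub>0\<close> makes it possible to bring membership at a given level to the finer levels only, where
  the Frobenius map is available.
\<close>

lemma Inf_le_if_contains_fine_fractions: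
  fixes S :: "real set" and p e\<^sub>0 :: nat
  assumes bdd: "bdd_below S" and p: "2 \<le> p" and r: "0 \<le> r"
    and S: "\<And>a e. e\<^sub>0 \<le> e \<Longrightarrow> r \<le> real a / real (p ^ e) \<Longrightarrow> real a / real (p ^ e) \<in> S"
  shows "Inf S \<le> r"
proof (rule field_le_epsilon)
  fix \<epsilon> :: real assume \<epsilon>: "0 < \<epsilon>"
  obtain k where k: "(1 / real p) ^ k < \<epsilon>"
    using real_arch_pow_inv[OF \<epsilon>, of "1 / real p"] p by auto
  define e where "e = max e\<^sub>0 k"
  have "(1 / real p) ^ e \<le> (1 / real p) ^ k"
    using p by (intro power_decreasing) (auto simp: e_def)
  with k have e: "1 / real (p ^ e) < \<epsilon>" by (simp add: power_divide)
  define a where "a = nat \<lceil>r * real (p ^ e)\<rceil>"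
  have pos: "0 < real (p ^ e)" using p by simp
  have a: "r * real (p ^ e) \<le> real a" "real a \<le> r * real (p ^ e) + 1"
    using r unfolding a_def by (simp_all add: of_nat_nat ceiling_le_iff)
  have "real a / real (p ^ e) \<in> S"
    using S[of e a] a(1) pos by (simp add: e_def pos_le_divide_eq)
  then have "Inf S \<le> real a / real (p ^ e)" using bdd by (rule cInf_lower)
  also have "\<dots> \<le> (r * real (p ^ e) + 1) / real (p ^ e)"
    using a(2) pos by (intro divide_right_mono) simp_all
  also have "\<dots> = r + 1 / real (p ^ e)" using pos by (simp add: add_divide_distrib)
  also have "\<dots> \<le> r + \<epsilon>" using e by simp
  finally show "Inf S \<le> r + \<epsilon>" .
qed

definition fpt_set :: "'a::field bipoly \<Rightarrow> real set" where
  "fpt_set g = {real a / real (CHAR('a) ^ e) | a e. in_frob (CHAR('a) ^ e) (g ^ a)}"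

lemma fpt_eq_Inf: "fpt g = Inf (fpt_set g)"
  by (simp add: fpt_def fpt_set_def)

lemma bdd_below_fpt_set: "bdd_below (fpt_set g)"
  by (rule bdd_belowI[of _ 0]) (auto simp: fpt_set_def)

lemma in_frob_const_mult_iff:
  fixes F :: "'a::field bipoly"
  assumes "c \<noteq> 0"
  shows "in_frob q (const c * F) \<longleftrightarrow> in_frob q F"
proof
  assume "in_frob q (const c * F)"
  then have "in_frob q (const c * F * const (inverse c))" by (rule in_frob_mult)
  also have "const c * F * const (inverse c) = const (c * inverse c) * F"
    by (simp add: const_mult mult_ac)
  finally show "in_frob q F" using assms by (simp add: const_def flip: one_pCons)
qed (simp add: in_frob_mult mult.commute)

lemma const_power: "const c ^ k = const (c ^ k)"
  by (induction k) (simp_all add: const_mult, simp add: const_def one_pCons)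

context coprime_linear_forms
begin

context
  fixes c :: 'a and m :: "nat \<Rightarrow> nat" and G :: "'a bipoly"
  assumes char: "prime CHAR('a)" and c: "c \<noteq> 0" and m: "\<And>i. i < n \<Longrightarrow> 0 < m i" and n: "0 < n"
    and G: "G = const c * mon m"
begin

lemma char_ge_2: "2 \<le> CHAR('a)"
  using char by (simp add: prime_ge_2_nat)

lemma deg_pos: "0 < deg m"
  unfolding deg_def using m n by (intro sum_pos) auto

lemma in_frob_G_power_iff: "in_frob q (G ^ a) \<longleftrightarrow> in_frob q (mon (\<lambda>i. a * m i))"
  by (simp add: G power_mult_distrib const_power in_frob_const_mult_iff c mon_power)

lemma mem_fpt_setI: "in_frob (CHAR('a) ^ e) (mon (\<lambda>i. a * m i)) \<Longrightarrow> real a / real (CHAR('a) ^ e) \<in> fpt_set G"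
  using in_frob_G_power_iff unfolding fpt_set_def by blast

lemma deg_scale: "deg (\<lambda>i. a * m i) = a * deg m"
  by (simp add: deg_def sum_distrib_left)

lemma fpt_le_two_div_degree: "fpt G \<le> 2 / deg m"
  unfolding fpt_eq_Inf
proof (rule Inf_le_if_contains_fine_fractions[OF bdd_below_fpt_set char_ge_2])
  fix a e assume "2 / real (deg m) \<le> real a / real (CHAR('a) ^ e)"
  then have "real (2 * CHAR('a) ^ e) \<le> real (a * deg m)"
    using deg_pos char_ge_2 by (simp add: field_simps)
  then have "2 * CHAR('a) ^ e \<le> deg (\<lambda>i. a * m i)"
    unfolding deg_scale of_nat_le_iff .
  then show "real a / real (CHAR('a) ^ e) \<in> fpt_set G"
    by (intro mem_fpt_setI in_frob_if_deg_ge)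
qed simp

text \<open>
  In characteristic \<open>p\<close> the \<open>q\<close>-th power of a linear form is a linear form in \<open>x ^ q\<close> and \<open>y ^ q\<close>, so it is
  enough that \<open>L i\<close> occurs at least \<open>q\<close> times.
\<close>

lemma fpt_le_inverse_multiplicity:
  assumes i: "i < n"
  shows "fpt G \<le> 1 / m i"
  unfolding fpt_eq_Inf
proof (rule Inf_le_if_contains_fine_fractions[OF bdd_below_fpt_set char_ge_2])
  fix a e assume "1 / real (m i) \<le> real a / real (CHAR('a) ^ e)"
  then have "real (CHAR('a) ^ e) \<le> real (a * m i)"
    using m[OF i] char_ge_2 by (simp add: field_simps)
  then have le: "CHAR('a) ^ e \<le> a * m i"
    unfolding of_nat_le_iff .
  obtain \<alpha> \<beta> where "L i = lin \<alpha> \<beta>" using form[OF i] by (rule form_one_conv_lin)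
  then have "in_frob (CHAR('a) ^ e) (L i ^ (CHAR('a) ^ e))"
    using in_frob_lin_power[OF char] by simp
  then have "in_frob (CHAR('a) ^ e) (L i ^ (CHAR('a) ^ e) * (L i ^ (a * m i - CHAR('a) ^ e) *
      mon ((\<lambda>i. a * m i)(i := 0))))"
    by (rule in_frob_mult)
  also have "L i ^ (CHAR('a) ^ e) * (L i ^ (a * m i - CHAR('a) ^ e) * mon ((\<lambda>i. a * m i)(i := 0)))
      = mon (\<lambda>i. a * m i)"
    unfolding mon_split[OF i, of "\<lambda>i. a * m i"] using le
    by (simp add: mult.assoc[symmetric] power_add[symmetric])
  finally show "real a / real (CHAR('a) ^ e) \<in> fpt_set G"
    by (rule mem_fpt_setI)
qed simp

lemma fpt_set_nonempty: "fpt_set G \<noteq> {}"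
proof -
  have "real 2 / real (CHAR('a) ^ 0) \<in> fpt_set G"
    using deg_pos by (intro mem_fpt_setI in_frob_if_deg_ge) (simp add: deg_scale)
  then show ?thesis by blast
qed

lemma fpt_pos: "0 < fpt G"
proof -
  have "1 / real (deg m) \<le> r" if mem: "r \<in> fpt_set G" for r
  proof -
    obtain a e where r: "r = real a / real (CHAR('a) ^ e)"
      and "in_frob (CHAR('a) ^ e) (mon (\<lambda>i. a * m i))"
      using mem in_frob_G_power_iff by (auto simp: fpt_set_def)
    then have "CHAR('a) ^ e \<le> a * deg m"
      using deg_ge_if_in_frob deg_scale by metis
    then have "real (CHAR('a) ^ e) \<le> real (a * deg m)" by (simp only: of_nat_le_iff)
    then show ?thesis
      unfolding r using deg_pos char_ge_2 by (simp add: field_simps)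
  qed
  then have "1 / real (deg m) \<le> fpt G"
    unfolding fpt_eq_Inf using fpt_set_nonempty by (intro cInf_greatest)
  moreover have "0 < 1 / real (deg m)" using deg_pos by simp
  ultimately show ?thesis by linarith
qed

text \<open>
  Since the threshold is below \<open>2 / D\<close>, some power of \<open>G\<close> of degree less than \<open>2 * q\<close> lies in
  \<open>(x ^ q, y ^ q)\<close>. A minimal exponent vector \<open>s\<close> below it at the level \<open>q\<close> governs all finer levels, so
  the threshold is the smallest number \<open>r\<close> with \<open>s i \<le> r * m i * q\<close> for all \<open>i\<close>.
\<close>

lemma fpt_less_two_div_degree_imp:
  assumes less: "fpt G < 2 / deg m"
  obtains i e s where "i < n" "fpt G * real (m i * CHAR('a) ^ e) = real s"
proof -
  obtain r where "r \<in> fpt_set G" "r < 2 / deg m"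
    using less unfolding fpt_eq_Inf cInf_less_iff[OF fpt_set_nonempty bdd_below_fpt_set] by blast
  then obtain a e where ae: "in_frob (CHAR('a) ^ e) (mon (\<lambda>i. a * m i))"
    "real a / real (CHAR('a) ^ e) < 2 / deg m"
    using in_frob_G_power_iff by (auto simp: fpt_set_def)
  define q where "q = CHAR('a) ^ e"
  define t where "t = (\<lambda>i. a * m i)"
  have q: "0 < q" using char_ge_2 by (simp add: q_def)
  have "real (a * deg m) < real (2 * q)"
    using ae(2) q deg_pos by (simp add: field_simps flip: q_def)
  then have t: "deg t < 2 * q" unfolding t_def deg_scale of_nat_less_iff .
  obtain s where s: "minimal_in_frob q s" and st: "\<And>i. i < n \<Longrightarrow> s i \<le> t i"
    using minimal_in_frob_exists ae(1) unfolding q_def t_def by blast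
  define R where "R = (\<lambda>i. real (s i) / real (m i * q)) ` {..<n}"
  have R: "finite R" "R \<noteq> {}" using n by (auto simp: R_def)
  have R_le: "Max R \<le> real b / real q' \<longleftrightarrow> (\<forall>i<n. q' * s i \<le> q * (b * m i))"
    if "0 < q'" for b q'
  proof -
    have "real (s i) / real (m i * q) \<le> real b / real q' \<longleftrightarrow> q' * s i \<le> q * (b * m i)"
      if "i < n" for i
    proof -
      have "real (s i) / real (m i * q) \<le> real b / real q' \<longleftrightarrow>
          real (q' * s i) \<le> real (q * (b * m i))"
        using m[OF that] q \<open>0 < q'\<close> by (simp add: field_simps)
      then show ?thesis by (simp only: of_nat_le_iff)
    qed
    then show ?thesis using R by (auto simp: R_def)
  qed
  have "fpt G = Max R"
  proof (rule antisym)
    show "fpt G \<le> Max R"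
      unfolding fpt_eq_Inf
    proof (rule Inf_le_if_contains_fine_fractions[OF bdd_below_fpt_set char_ge_2])
      show "0 \<le> Max R"
        using R by (subst Max_ge_iff) (auto simp: R_def)
    next
      fix b e' assume e': "e \<le> e'" and "Max R \<le> real b / real (CHAR('a) ^ e')"
      then have "\<forall>i<n. CHAR('a) ^ e' * s i \<le> q * (b * m i)"
        using R_le[of "CHAR('a) ^ e'" b] char_ge_2 by simp
      moreover have q': "CHAR('a) ^ e' = q * CHAR('a) ^ (e' - e)"
        using e' by (simp add: q_def flip: power_add)
      ultimately have le: "\<forall>i<n. CHAR('a) ^ (e' - e) * s i \<le> b * m i"
        using q by (simp add: mult.assoc)
      have "in_frob (q * CHAR('a) ^ (e' - e)) (mon s ^ CHAR('a) ^ (e' - e))"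
        using s char by (intro in_frob_power) (auto simp: minimal_in_frob_def)
      then have "in_frob (CHAR('a) ^ e') (mon (\<lambda>i. CHAR('a) ^ (e' - e) * s i))"
        by (simp only: q' mon_power)
      then have "in_frob (CHAR('a) ^ e') (mon (\<lambda>i. b * m i))"
        by (rule in_frob_mono) (use le in simp)
      then show "real b / real (CHAR('a) ^ e') \<in> fpt_set G" by (rule mem_fpt_setI)
    qed
    show "Max R \<le> fpt G"
      unfolding fpt_eq_Inf
    proof (rule cInf_greatest[OF fpt_set_nonempty])
      fix r assume "r \<in> fpt_set G"
      then obtain b e' where r: "r = real b / real (CHAR('a) ^ e')"
        and b: "in_frob (CHAR('a) ^ e') (mon (\<lambda>i. b * m i))"
        using in_frob_G_power_iff by (auto simp: fpt_set_def)
      define q' where "q' = CHAR('a) ^ e'"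
      have q': "0 < q'" using char_ge_2 by (simp add: q'_def)
      show "Max R \<le> r"
      \<comment> \<open>Only fractions below \<open>a / q\<close> need the minimality of \<open>s\<close>; the others exceed the maximum because
        \<open>s\<close> lies below \<open>a * m\<close>.\<close>
      proof (cases "b * q \<le> a * q'")
        case True
        have "q' * s i \<le> q * (b * m i)" if "i < n" for i
        proof (rule minimal_in_frob_dominates[OF char q'_def s st t])
          have "in_frob (q' * q) (mon (\<lambda>i. b * m i) ^ q)"
            using b unfolding q'_def by (intro in_frob_power[OF char q_def])
          then show "in_frob (q * q') (mon (\<lambda>i. q * (b * m i)))"
            by (simp only: mon_power mult.commute[of q q'])
          show "q * (b * m j) \<le> q' * t j" for j
            using True mult_le_mono1[of "b * q" "a * q'" "m j"] by (simp add: t_def mult_ac)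
        qed (use that in simp_all)
        then show ?thesis unfolding r q'_def[symmetric] R_le[OF q'] by blast
      next
        case False
        have "q' * s i \<le> q * (b * m i)" if "i < n" for i
        proof -
          have "q' * s i \<le> q' * (a * m i)" using st[OF that] by (simp add: t_def)
          also have "\<dots> \<le> (b * q) * m i" using False by (simp add: mult.assoc[symmetric] mult.commute[of q' a])
          finally show ?thesis by (simp add: mult_ac)
        qed
        then show ?thesis unfolding r q'_def[symmetric] R_le[OF q'] by blast
      qed
    qed
  qed
  with Max_in[OF R] obtain i where i: "i < n" "fpt G = real (s i) / real (m i * q)"
    by (auto simp: R_def)
  then have "fpt G * real (m i * CHAR('a) ^ e) = real (s i)"
    using m[OF i(1)] q by (simp add: q_def)
  with i(1) that show ?thesis by blast
qed

end

end

section \<open>Extension of the base field\<close>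

text \<open>
  The ideal \<open>(x ^ q, y ^ q)\<close> is defined by the vanishing of coefficients, which an injective
  homomorphism of fields does not change.
\<close>

lemma fpt_map_to_ac:
  fixes G :: "'a::field bipoly"
  shows "fpt (map_bipoly to_ac G) = fpt G"
proof -
  have co: "coeff (coeff (map_bipoly to_ac F) j) i = to_ac (coeff (coeff F j) i)"
    for F :: "'a bipoly" and i j
    by (simp add: map_bipoly_def coeff_map_poly)
  have mult: "map_bipoly to_ac (F * H) = map_bipoly to_ac F * map_bipoly to_ac H" for F H :: "'a bipoly"
    by (intro bipoly_eqI) (simp add: co coeff_bipoly_mult to_ac_sum)
  have one: "map_bipoly to_ac (1 :: 'a bipoly) = 1"
    by (intro bipoly_eqI) (simp add: co coeff_1)
  have power: "map_bipoly to_ac (G ^ a) = map_bipoly to_ac G ^ a" for a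
    by (induction a) (simp_all add: one mult)
  have "in_frob q (map_bipoly to_ac G ^ a) \<longleftrightarrow> in_frob q (G ^ a)" for q a
    by (simp add: in_ideal2_powers_iff co flip: power)
  then show ?thesis by (simp add: fpt_def)
qed

section \<open>Substitution and Jacobians\<close>

lemma comm_ring_hom_subst_xy: "comm_ring_hom (\<lambda>F. subst_xy F a b)"
proof -
  have "comm_ring_hom (const :: 'a \<Rightarrow> 'a bipoly)"
    by unfold_locales (simp_all add: const_def one_pCons)
  then interpret c: map_poly_comm_ring_hom "const :: 'a \<Rightarrow> 'a bipoly"
    by (simp add: map_poly_comm_ring_hom_def)
  have "comm_ring_hom (\<lambda>q. poly (map_poly const q) a)"
    by unfold_locales (simp_all add: hom_distribs)
  then interpret h: map_poly_comm_ring_hom "\<lambda>q. poly (map_poly const q) a"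
    by (simp add: map_poly_comm_ring_hom_def)
  show ?thesis
    unfolding subst_xy_def by unfold_locales (simp_all add: hom_distribs)
qed

interpretation subst_xy: comm_ring_hom "\<lambda>F. subst_xy F a b" for a b :: "'a::comm_ring_1 bipoly"
  by (rule comm_ring_hom_subst_xy)

lemma const_0 [simp]: "const 0 = 0" and const_1 [simp]: "const 1 = 1"
  by (simp_all add: const_def one_pCons)

lemma subst_xy_const [simp]: "subst_xy (const c) a b = const c"
proof -
  have "subst_xy [:[:c:]:] a b = const c"
    by (simp add: subst_xy_def Polynomial.map_poly_pCons)
  then show ?thesis by (simp add: const_def)
qed

lemma subst_xy_var_x [simp]: "subst_xy var_x a b = a"
  by (simp add: subst_xy_def var_x_def Polynomial.map_poly_pCons)

lemma subst_xy_var_y [simp]: "subst_xy var_y a b = b"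
  by (simp add: subst_xy_def var_y_def Polynomial.map_poly_pCons map_poly_1')

lemma subst_xy_lin: "subst_xy (lin \<alpha> \<beta>) a b = const \<alpha> * a + const \<beta> * b"
  by (simp add: lin_conv_vars subst_xy.hom_add subst_xy.hom_mult)

lemma chart_map_Cons:
  "chart_map (Some c # w) = (fst (chart_map w), fst (chart_map w) * (snd (chart_map w) + const c))"
  "chart_map (None # w) = (fst (chart_map w) * snd (chart_map w), fst (chart_map w))"
  by (simp_all add: subst_xy.hom_add subst_xy.hom_mult)

declare chart_map.simps(2) [simp del]

abbreviation deriv_x :: "'a::{comm_ring_1,semiring_no_zero_divisors} bipoly \<Rightarrow> 'a bipoly" where
  "deriv_x F \<equiv> map_poly pderiv F"

lemma deriv_x_add: "deriv_x (F + G) = deriv_x F + deriv_x G"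
  by (intro poly_eqI) (simp add: coeff_map_poly pderiv_add)

lemma deriv_x_mult: "deriv_x (F * G) = deriv_x F * G + F * deriv_x G"
proof (rule poly_eqI)
  fix j
  have "coeff (deriv_x (F * G)) j
      = (\<Sum>i\<le>j. pderiv (coeff F i) * coeff G (j - i) + coeff F i * pderiv (coeff G (j - i)))"
    by (simp add: coeff_map_poly coeff_mult pderiv_sum pderiv_mult algebra_simps)
  then show "coeff (deriv_x (F * G)) j = coeff (deriv_x F * G + F * deriv_x G) j"
    by (simp add: coeff_map_poly coeff_mult sum.distrib)
qed

lemma deriv_y_mult: "pderiv (F * G) = pderiv F * G + F * pderiv (G :: 'a::idom bipoly)"
  by (simp add: pderiv_mult algebra_simps)

lemma deriv_const [simp]: "deriv_x (const c) = 0" "pderiv (const c) = 0"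
  by (simp_all add: const_def Polynomial.map_poly_pCons pderiv_pCons)

lemma deriv_vars [simp]:
  "deriv_x (var_x :: complex bipoly) = 1" "pderiv (var_x :: complex bipoly) = 0"
  "deriv_x (var_y :: complex bipoly) = 0" "pderiv (var_y :: complex bipoly) = 1"
  by (simp_all add: var_x_def var_y_def Polynomial.map_poly_pCons pderiv_pCons one_pCons)

lemma jacobian_blowup:
  "jacobian (a, a * (b + const c)) = a * jacobian (a, b)"
  "jacobian (a * b, a) = - (a * jacobian (a, b))"
  by (simp_all add: jacobian_def deriv_x_add deriv_x_mult deriv_y_mult pderiv_add algebra_simps)

lemma jacobian_linear_combinations:
  "jacobian (const \<alpha> * a + const \<beta> * b, const \<gamma> * a + const \<delta> * b)
     = const (\<alpha> * \<delta> - \<beta> * \<gamma>) * jacobian (a, b)"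
proof -
  have "const (\<alpha> * \<delta> - \<beta> * \<gamma>) = const \<alpha> * const \<delta> - const \<beta> * const \<gamma>"
    by (simp add: const_def)
  then show ?thesis
    by (simp only: jacobian_def fst_conv snd_conv deriv_x_add deriv_x_mult deriv_y_mult pderiv_add
        deriv_const) (simp add: algebra_simps)
qed

text \<open>
  Each blow-up multiplies the Jacobian by \<open>\<plusminus>a\<close>, where \<open>a\<close> is the pull-back of the equation of its
  exceptional curve; \<open>a\<close> cannot vanish identically, as it is a component of a map with nonzero Jacobian.
\<close>

lemma jacobian_chart_nonzero: "jacobian (chart_map w) \<noteq> 0"
proof (induction w)
  case Nil
  show ?case by (simp add: jacobian_def)
next
  case (Cons q w)
  obtain a b where ab: "chart_map w = (a, b)" by fastforce
  with Cons have "jacobian (a, b) \<noteq> 0" by simp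
  moreover from this have "a \<noteq> 0" by (auto simp: jacobian_def)
  ultimately show ?case
    by (cases q) (simp_all add: chart_map_Cons ab jacobian_blowup)
qed

lemma exceptional_curve_over_origin:
  "var_x dvd fst (chart_map (w @ [Some 0])) \<and> var_x dvd snd (chart_map (w @ [Some 0]))"
proof (induction w)
  case (Cons q w)
  then show ?case by (cases q) (auto simp: chart_map_Cons)
qed (simp add: chart_map_Cons)

lemma prime_elem_var_x: "prime_elem (var_x :: complex bipoly)"
  unfolding var_x_conv_lin by (rule prime_elem_lin) simp

text \<open>
  The logarithmic derivation \<open>x * d/dx\<close> and the derivation \<open>d/dy\<close> both preserve the ideals
  \<open>(x ^ p)\<close>.
\<close>

lemma var_x_power_dvd_derivs:
  fixes F :: "complex bipoly"
  assumes "var_x ^ p dvd F"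
  shows "var_x ^ p dvd var_x * deriv_x F" "var_x ^ p dvd pderiv F"
proof -
  obtain h where h: "F = var_x ^ p * h" using assms ..
  have x: "var_x * deriv_x (var_x ^ p :: complex bipoly) = of_nat p * var_x ^ p"
    by (induction p) (simp_all add: deriv_x_mult algebra_simps Polynomial.map_poly_pCons one_pCons)
  have y: "pderiv (var_x ^ p :: complex bipoly) = 0"
    by (induction p) (simp_all add: deriv_y_mult)
  have "var_x * deriv_x F = (var_x * deriv_x (var_x ^ p)) * h + var_x ^ p * (var_x * deriv_x h)"
    by (simp add: h deriv_x_mult algebra_simps)
  also have "\<dots> = var_x ^ p * (of_nat p * h + var_x * deriv_x h)"
    unfolding x by (simp add: algebra_simps)
  finally show "var_x ^ p dvd var_x * deriv_x F" by simp
  show "var_x ^ p dvd pderiv F" by (simp add: h deriv_y_mult y)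
qed

text \<open>
  Multiplied by \<open>x\<close>, the Jacobian is a combination of products of a logarithmic derivative
  with a derivative along the curve \<open>x = 0\<close>, one factor for \<open>F\<close> and one for \<open>G\<close>.
\<close>

lemma orders_le_order_jacobian:
  fixes F G :: "complex bipoly"
  assumes "jacobian (F, G) \<noteq> 0"
  shows "multiplicity var_x F + multiplicity var_x G \<le> Suc (multiplicity var_x (jacobian (F, G)))"
proof -
  define p where "p = multiplicity var_x F"
  define q where "q = multiplicity var_x G"
  have "var_x ^ p dvd F" "var_x ^ q dvd G" by (simp_all add: p_def q_def multiplicity_dvd)
  note d = var_x_power_dvd_derivs[OF this(1)] var_x_power_dvd_derivs[OF this(2)]
  have "var_x ^ (p + q) dvd (var_x * deriv_x F) * pderiv G - pderiv F * (var_x * deriv_x G)"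
    unfolding power_add using d by (intro dvd_diff mult_dvd_mono)
  also have "\<dots> = var_x * jacobian (F, G)" by (simp add: jacobian_def algebra_simps)
  finally have "p + q \<le> multiplicity var_x (var_x * jacobian (F, G))"
    using assms prime_elem_var_x prime_elem_not_unit by (intro multiplicity_geI) auto
  also have "\<dots> = Suc (multiplicity var_x (jacobian (F, G)))"
    using assms prime_elem_var_x prime_elem_not_unit by (intro multiplicity_times_same) auto
  finally show ?thesis by (simp add: p_def q_def)
qed

lemma pull_back_lin:
  "pull_back w (lin \<alpha> \<beta>) = const \<alpha> * fst (chart_map w) + const \<beta> * snd (chart_map w)"
  by (simp add: pull_back_def subst_xy_lin)

lemma jacobian_pull_back_lin:
  "jacobian (pull_back w (lin \<alpha> \<beta>), pull_back w (lin \<gamma> \<delta>))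
     = const (\<alpha> * \<delta> - \<beta> * \<gamma>) * jacobian (chart_map w)"
  unfolding pull_back_lin jacobian_linear_combinations by simp

lemma orders_of_independent_lines:
  assumes "\<alpha> * \<delta> - \<beta> * \<gamma> \<noteq> 0"
  shows "multiplicity var_x (pull_back w (lin \<alpha> \<beta>)) + multiplicity var_x (pull_back w (lin \<gamma> \<delta>))
           \<le> Suc (multiplicity var_x (jacobian (chart_map w)))"
proof -
  have "multiplicity var_x (const (\<alpha> * \<delta> - \<beta> * \<gamma>) * jacobian (chart_map w))
      = multiplicity var_x (jacobian (chart_map w))"
    using assms by (simp add: multiplicity_times_unit_right is_unit_const)
  then show ?thesis
    using orders_le_order_jacobian[of "pull_back w (lin \<alpha> \<beta>)" "pull_back w (lin \<gamma> \<delta>)"]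
      assms jacobian_chart_nonzero[of w]
    by (simp add: jacobian_pull_back_lin)
qed

lemma pull_back_lin_nonzero:
  assumes "\<alpha> \<noteq> 0 \<or> \<beta> \<noteq> 0"
  shows "pull_back w (lin \<alpha> \<beta>) \<noteq> 0"
proof
  assume *: "pull_back w (lin \<alpha> \<beta>) = 0"
  obtain \<gamma> \<delta> where "\<alpha> * \<delta> - \<beta> * \<gamma> \<noteq> 0"
    using assms by (rule independent_vector_exists)
  moreover have "const (\<alpha> * \<delta> - \<beta> * \<gamma>) * jacobian (chart_map w) = 0"
    using * jacobian_pull_back_lin[of w \<alpha> \<beta> \<gamma> \<delta>] by (simp add: jacobian_def)
  ultimately show False using jacobian_chart_nonzero[of w] by simp
qed


section \<open>The log canonical threshold of a product of linear forms\<close>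

text \<open>
  If some \<open>v i\<close> exceeds \<open>N / 2\<close>, then the others are at most \<open>N - v i\<close> and the weighted sum is at most
  \<open>m i * v i + k * (N - v i)\<close>, where \<open>k\<close> is the sum of the other weights. This is an affine function
  of \<open>v i\<close> on the interval from \<open>N / 2\<close> to \<open>N\<close>, with the values \<open>(m i + k) * N / 2\<close> and \<open>m i * N\<close> at its
  ends.
\<close>

lemma weighted_order_bound:
  fixes m v :: "nat \<Rightarrow> nat" and N n :: nat
  assumes le: "\<And>i. i < n \<Longrightarrow> v i \<le> N"
    and pair: "\<And>i j. i < n \<Longrightarrow> j < n \<Longrightarrow> i \<noteq> j \<Longrightarrow> v i + v j \<le> N"
  shows "2 * (\<Sum>i<n. m i * v i) \<le> (\<Sum>i<n. m i) * N \<or> (\<exists>i<n. (\<Sum>i<n. m i * v i) \<le> m i * N)"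
proof (cases "\<exists>i<n. N < 2 * v i")
  case False
  then have "2 * (m i * v i) \<le> m i * N" if "i < n" for i
  proof -
    have "2 * v i \<le> N" using False that not_less by blast
    then have "m i * (2 * v i) \<le> m i * N" by (rule mult_le_mono2)
    then show ?thesis by (simp only: mult_ac)
  qed
  then have "(\<Sum>i<n. 2 * (m i * v i)) \<le> (\<Sum>i<n. m i * N)"
    by (intro sum_mono) auto
  then show ?thesis by (simp add: sum_distrib_left sum_distrib_right)
next
  case True
  then obtain i where i: "i < n" "N < 2 * v i" by blast
  define k where "k = (\<Sum>j\<in>{..<n} - {i}. m j)"
  define S where "S = (\<Sum>i<n. m i * v i)"
  have sum_m: "(\<Sum>j<n. m j) = m i + k"
    using i by (simp add: k_def sum.remove[of "{..<n}" i])
  have "(\<Sum>j\<in>{..<n} - {i}. m j * v j) \<le> (\<Sum>j\<in>{..<n} - {i}. m j * (N - v i))"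
    using pair[OF i(1)] by (intro sum_mono mult_left_mono) fastforce+
  then have "S \<le> m i * v i + k * (N - v i)"
    using i by (simp add: S_def k_def sum.remove[of "{..<n}" i] sum_distrib_right)
  then have "real S \<le> real (m i * v i + k * (N - v i))" by (simp only: of_nat_le_iff)
  then have S: "real S \<le> real (m i) * real (v i) + real k * (real N - real (v i))"
    using le[OF i(1)] by (simp add: of_nat_diff)
  show ?thesis
  proof (cases "k \<le> m i")
    case True
    then have "0 \<le> (real (m i) - real k) * (real N - real (v i))"
      using le[OF i(1)] by (intro mult_nonneg_nonneg) auto
    then have "real S \<le> real (m i * N)" using S by (simp add: algebra_simps)
    then have "S \<le> m i * N" by (simp only: of_nat_le_iff)
    then show ?thesis using i(1) unfolding S_def by blast
  next
    case False
    have "(real (m i) - real k) * (2 * real (v i) - real N) \<le> 0"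
      using False i(2) by (intro mult_nonpos_nonneg) auto
    then have "real (2 * S) \<le> real ((m i + k) * N)" using S by (simp add: algebra_simps)
    then have "2 * S \<le> (m i + k) * N" by (simp only: of_nat_le_iff)
    then show ?thesis unfolding S_def sum_m by blast
  qed
qed

text \<open>
  Normal crossings along the coordinate axes. On the blow-up of the origin, the total transform of
  a form has this shape in each of the standard charts, and unlike the general
  condition this one is clearly stable under products.
\<close>

definition monomial_up_to_unit :: "complex bipoly \<Rightarrow> bool" where
  "monomial_up_to_unit h \<longleftrightarrow> (\<exists>v a b. at_origin v \<noteq> 0 \<and> h = v * var_x ^ a * var_y ^ b)"

lemma monomial_up_to_unitI: "at_origin v \<noteq> 0 \<Longrightarrow> h = v * var_x ^ a * var_y ^ b \<Longrightarrow> monomial_up_to_unit h"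
  unfolding monomial_up_to_unit_def by blast

lemma monomial_up_to_unit_mult:
  assumes "monomial_up_to_unit g" "monomial_up_to_unit h"
  shows "monomial_up_to_unit (g * h)"
proof -
  obtain v a b where g: "at_origin v \<noteq> 0" "g = v * var_x ^ a * var_y ^ b"
    using assms(1) by (auto simp: monomial_up_to_unit_def)
  obtain w c d where h: "at_origin w \<noteq> 0" "h = w * var_x ^ c * var_y ^ d"
    using assms(2) by (auto simp: monomial_up_to_unit_def)
  have "g * h = (v * w) * var_x ^ (a + c) * var_y ^ (b + d)"
    unfolding g h power_add by (simp only: mult_ac)
  moreover have "at_origin (v * w) \<noteq> 0" using g h by simp
  ultimately show ?thesis by (rule monomial_up_to_unitI[rotated])
qed

lemma monomial_up_to_unit_const: "c \<noteq> 0 \<Longrightarrow> monomial_up_to_unit (const c)"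
  by (rule monomial_up_to_unitI[of "const c" _ 0 0]) simp_all

lemma monomial_up_to_unit_power: "monomial_up_to_unit h \<Longrightarrow> monomial_up_to_unit (h ^ k)"
  using monomial_up_to_unit_const[of 1] by (induction k) (simp_all add: monomial_up_to_unit_mult)

lemma monomial_up_to_unit_prod:
  assumes "finite I" "\<And>i. i \<in> I \<Longrightarrow> monomial_up_to_unit (h i)"
  shows "monomial_up_to_unit (prod h I)"
  using assms monomial_up_to_unit_const[of 1]
  by (induction I rule: finite_induct) (simp_all add: monomial_up_to_unit_mult)

lemma at_origin_add [simp]: "at_origin (F + G) = at_origin F + at_origin G"
  by (simp add: at_origin_def)

lemma at_origin_vars [simp]: "at_origin var_x = 0" "at_origin var_y = 0"
  by (simp_all add: at_origin_def var_x_def var_y_def)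

lemma monomial_up_to_unit_affine:
  assumes "\<gamma> \<noteq> 0 \<or> \<delta> \<noteq> 0"
  shows "monomial_up_to_unit (const \<gamma> + const \<delta> * var_y)"
proof (cases "\<gamma> = 0")
  case True
  then show ?thesis
    using assms by (intro monomial_up_to_unitI[of "const \<delta>" _ 0 1]) simp_all
next
  case False
  then show ?thesis
    by (intro monomial_up_to_unitI[of "const \<gamma> + const \<delta> * var_y" _ 0 0]) simp_all
qed

lemma jacobian_vars: "jacobian (var_x, var_y) = 1"
  by (simp add: jacobian_def)

lemma snc_if_monomial_up_to_unit:
  assumes "monomial_up_to_unit h"
  shows "snc_at_origin h"
proof -
  obtain v a b where v: "at_origin v \<noteq> 0" "h = v * var_x ^ a * var_y ^ b"
    using assms by (auto simp: monomial_up_to_unit_def)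
  then show ?thesis
    unfolding snc_at_origin_def
    by (intro exI[of _ var_x] exI[of _ var_y] exI[of _ 1] exI[of _ v] exI[of _ a] exI[of _ b])
      (simp add: jacobian_vars)
qed

lemma Nil_mem_admissible:
  assumes "admissible_centres T" "w \<in> T"
  shows "[] \<in> T"
  using assms(2)
proof (induction w rule: rev_induct)
  case (snoc q w)
  then show ?case using assms(1) by (auto simp: admissible_centres_def)
qed

locale complex_linear_forms = coprime_linear_forms L n for L :: "nat \<Rightarrow> complex bipoly" and n
begin

context
  fixes c :: complex and m :: "nat \<Rightarrow> nat" and F :: "complex bipoly"
  assumes c: "c \<noteq> 0" and m: "\<And>i. i < n \<Longrightarrow> 0 < m i" and n: "0 < n"
    and F: "F = const c * mon m"
begin

lemma pull_back_F:
  "pull_back w F = const c * (\<Prod>i<n. pull_back w (L i) ^ m i)"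
  by (simp add: pull_back_def F mon_def subst_xy.hom_mult subst_xy.hom_prod subst_xy.hom_power)

text \<open>
  In a chart at a point of the exceptional curve, each line becomes \<open>x\<close> times an affine
  polynomial in \<open>y\<close>, which is either a unit at the point or a multiple of \<open>y\<close>.
\<close>

lemma log_resolution_by_one_blowup: "log_resolution F {[]}"
  unfolding log_resolution_def
proof (intro conjI ballI)
  show "admissible_centres {[]}" by (simp add: admissible_centres_def)
  fix w assume "w \<in> points_over_origin {[]}"
  then obtain q where w: "w = [q]"
    by (cases w rule: rev_cases) (auto simp: points_over_origin_def)
  have x: "monomial_up_to_unit var_x"
    by (rule monomial_up_to_unitI[of 1 _ 1 0]) simp_all
  have L: "monomial_up_to_unit (pull_back w (L i))" if less: "i < n" for i
  proof -
    obtain \<alpha> \<beta> where l: "L i = lin \<alpha> \<beta>" and nz: "\<alpha> \<noteq> 0 \<or> \<beta> \<noteq> 0"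
      using form[OF less] by (rule form_one_conv_lin)
    show ?thesis
    proof (cases q)
      case None
      have "pull_back w (L i) = var_x * (const \<beta> + const \<alpha> * var_y)"
        by (simp add: pull_back_def l subst_xy_lin w None chart_map_Cons algebra_simps)
      then show ?thesis
        using monomial_up_to_unit_mult[OF x monomial_up_to_unit_affine[of \<beta> \<alpha>]] nz by auto
    next
      case (Some a)
      have "const (\<alpha> + \<beta> * a) = const \<alpha> + const \<beta> * const a"
        by (simp add: const_def)
      then have "pull_back w (L i) = var_x * (const (\<alpha> + \<beta> * a) + const \<beta> * var_y)"
        by (simp add: pull_back_def l subst_xy_lin w Some chart_map_Cons algebra_simps)
      moreover have "\<alpha> + \<beta> * a \<noteq> 0 \<or> \<beta> \<noteq> 0" using nz by auto
      ultimately show ?thesis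
        by (simp only: monomial_up_to_unit_mult[OF x] monomial_up_to_unit_affine)
    qed
  qed
  have "monomial_up_to_unit (pull_back w F)"
    unfolding pull_back_F using c L
    by (intro monomial_up_to_unit_mult monomial_up_to_unit_const monomial_up_to_unit_prod
        monomial_up_to_unit_power) auto
  moreover have "monomial_up_to_unit (jacobian (chart_map w))"
  proof -
    have "const (- 1) = (- 1 :: complex bipoly)" by (simp add: const_def one_pCons)
    then have "jacobian (chart_map w) = var_x \<or> jacobian (chart_map w) = const (- 1) * var_x"
      by (cases q) (simp_all add: w chart_map_Cons jacobian_blowup jacobian_vars)
    then show ?thesis
      using x monomial_up_to_unit_mult[OF monomial_up_to_unit_const x, of "- 1"] by auto
  qed
  ultimately show "snc_at_origin (pull_back w F * jacobian (chart_map w))"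
    by (intro snc_if_monomial_up_to_unit monomial_up_to_unit_mult)
qed

lemma pull_back_L_nonzero: "i < n \<Longrightarrow> pull_back w (L i) \<noteq> 0"
  using form[of i] pull_back_lin_nonzero form_one_conv_lin[of "L i"] by metis

lemma ord_exc_F:
  "ord_exc w F = (\<Sum>i<n. m i * multiplicity var_x (pull_back (w @ [Some 0]) (L i)))"
proof -
  have "(\<Prod>i<n. pull_back (w @ [Some 0]) (L i) ^ m i) \<noteq> 0"
    using pull_back_L_nonzero by simp
  then have "ord_exc w F = multiplicity var_x (\<Prod>i<n. pull_back (w @ [Some 0]) (L i) ^ m i)"
    using c by (simp add: ord_exc_def pull_back_F multiplicity_times_unit_right is_unit_const)
  also have "\<dots> = (\<Sum>i<n. multiplicity var_x (pull_back (w @ [Some 0]) (L i) ^ m i))"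
    using pull_back_L_nonzero
    by (intro prime_elem_multiplicity_prod_distrib prime_elem_var_x) auto
  also have "\<dots> = (\<Sum>i<n. m i * multiplicity var_x (pull_back (w @ [Some 0]) (L i)))"
    using pull_back_L_nonzero
    by (intro sum.cong refl prime_elem_multiplicity_power_distrib prime_elem_var_x) auto
  finally show ?thesis .
qed

lemma ord_exc_F_pos: "0 < ord_exc w F"
proof -
  have "0 < multiplicity var_x (pull_back (w @ [Some 0]) (L i))" if less: "i < n" for i
  proof -
    obtain \<alpha> \<beta> where l: "L i = lin \<alpha> \<beta>" using form[OF less] by (rule form_one_conv_lin)
    have "var_x dvd pull_back (w @ [Some 0]) (L i)"
      unfolding l pull_back_lin using exceptional_curve_over_origin[of w] by (intro dvd_add dvd_mult) auto
    then show ?thesis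
      using pull_back_L_nonzero[OF that] prime_elem_not_unit[OF prime_elem_var_x]
      by (simp add: multiplicity_gt_zero_iff)
  qed
  then show ?thesis unfolding ord_exc_F using n m by (intro sum_pos) auto
qed

definition threshold :: real where
  "threshold = Min (insert (2 / deg m) ((\<lambda>i. 1 / m i) ` {..<n}))"

lemma threshold_le: "threshold \<le> 2 / deg m" "i < n \<Longrightarrow> threshold \<le> 1 / m i"
  unfolding threshold_def by (auto intro: Min_le)

text \<open>
  With \<open>N = ord K + 1\<close>, the orders of the lines along an exceptional curve are bounded by \<open>N\<close> and
  add up to at most \<open>N\<close> in pairs, so the order of \<open>F\<close> is at most \<open>D * N / 2\<close> or at most some
  \<open>m i * N\<close>.
\<close>

lemma threshold_le_exceptional:
  "threshold \<le> (real (ord_exc_canonical w) + 1) / real (ord_exc w F)"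
proof -
  define N where "N = Suc (ord_exc_canonical w)"
  define v where "v i = multiplicity var_x (pull_back (w @ [Some 0]) (L i))" for i
  have S: "ord_exc w F = (\<Sum>i<n. m i * v i)" by (simp add: ord_exc_F v_def)
  have pair: "v i + v j \<le> N" if less: "i < n" "j < n" "i \<noteq> j" for i j
  proof -
    obtain \<alpha> \<beta> where i: "L i = lin \<alpha> \<beta>" using form[OF less(1)] by (rule form_one_conv_lin)
    obtain \<gamma> \<delta> where j: "L j = lin \<gamma> \<delta>" using form[OF less(2)] by (rule form_one_conv_lin)
    have "\<alpha> * \<delta> - \<beta> * \<gamma> \<noteq> 0"
      using cop[OF that] unfolding i j by (rule coprime_lin_imp_det_nonzero)
    then show ?thesis
      using orders_of_independent_lines unfolding v_def N_def i j ord_exc_canonical_def by blast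
  qed
  have le: "v i \<le> N" if less: "i < n" for i
  proof -
    obtain \<alpha> \<beta> where i: "L i = lin \<alpha> \<beta>" and nz: "\<alpha> \<noteq> 0 \<or> \<beta> \<noteq> 0"
      using form[OF less] by (rule form_one_conv_lin)
    \<comment> \<open>There may be only one line; any independent form serves as its partner.\<close>
    obtain \<gamma> \<delta> where "\<alpha> * \<delta> - \<beta> * \<gamma> \<noteq> 0"
      using nz by (rule independent_vector_exists)
    then show ?thesis
      using orders_of_independent_lines[of \<alpha> \<delta> \<beta> \<gamma> "w @ [Some 0]"]
      unfolding v_def N_def i ord_exc_canonical_def by linarith
  qed
  have pos: "0 < ord_exc w F" by (rule ord_exc_F_pos)
  have dpos: "0 < deg m" unfolding deg_def using m n by (intro sum_pos) auto
  from weighted_order_bound[of n v N m, OF le pair] show ?thesis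
  proof
    assume "2 * (\<Sum>i<n. m i * v i) \<le> (\<Sum>i<n. m i) * N"
    then have "2 * ord_exc w F \<le> deg m * N" by (simp only: S deg_def)
    then have "real (2 * ord_exc w F) \<le> real (deg m * N)" by (simp only: of_nat_le_iff)
    then have "2 / deg m \<le> (real (ord_exc_canonical w) + 1) / real (ord_exc w F)"
      using pos dpos by (simp add: N_def field_simps)
    with threshold_le(1) show ?thesis by linarith
  next
    assume "\<exists>i<n. (\<Sum>i<n. m i * v i) \<le> m i * N"
    then obtain i where i: "i < n" "ord_exc w F \<le> m i * N" using S by auto
    then have "real (ord_exc w F) \<le> real (m i * N)" by (simp only: of_nat_le_iff)
    then have "1 / m i \<le> (real (ord_exc_canonical w) + 1) / real (ord_exc w F)"
      using pos m[OF i(1)] by (simp add: N_def field_simps)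
    with threshold_le(2)[OF i(1)] show ?thesis by linarith
  qed
qed

lemma first_blowup:
  "(real (ord_exc_canonical []) + 1) / real (ord_exc [] F) = 2 / deg m"
proof -
  have one: "multiplicity var_x (pull_back [Some 0] (L i)) = 1" if less: "i < n" for i
  proof -
    obtain \<alpha> \<beta> where l: "L i = lin \<alpha> \<beta>" and nz: "\<alpha> \<noteq> 0 \<or> \<beta> \<noteq> 0"
      using form[OF less] by (rule form_one_conv_lin)
    have "pull_back [Some 0] (L i) = var_x * (const \<alpha> + const \<beta> * var_y)"
      by (simp add: pull_back_def l subst_xy_lin chart_map_Cons algebra_simps)
    moreover have "\<not> var_x dvd const \<alpha> + const \<beta> * var_y"
    proof
      assume "var_x dvd const \<alpha> + const \<beta> * var_y"
      then obtain h where "const \<alpha> + const \<beta> * var_y = var_x * h" ..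
      then have h: "const \<alpha> + const \<beta> * var_y = h * var_x ^ 1" by (simp only: power_one_right mult.commute)
      have "coeff (coeff (const \<alpha> + const \<beta> * var_y) 0) 0 = 0"
        "coeff (coeff (const \<alpha> + const \<beta> * var_y) 1) 0 = 0"
        unfolding h coeff_mult_var_x_power by simp_all
      then show False using nz by (simp add: const_def var_y_def)
    qed
    ultimately show ?thesis
      using prime_elem_var_x prime_elem_not_unit[OF prime_elem_var_x]
      by (intro multiplicity_eqI) auto
  qed
  have "ord_exc_canonical [] = 1"
    using prime_elem_var_x by (simp add: ord_exc_canonical_def chart_map_Cons jacobian_blowup(1)[of _ _ 0, simplified] jacobian_vars)
  moreover have "ord_exc [] F = deg m"
    unfolding ord_exc_F deg_def using one by (intro sum.cong) auto
  ultimately show ?thesis by simp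
qed

lemma multiplicity_L:
  assumes "i < n"
  shows "multiplicity (L i) F = m i"
proof (rule multiplicity_eqI)
  have eq: "F = L i ^ m i * (const c * mon (m(i := 0)))"
    unfolding F mon_split[OF assms, of m] by (simp only: mult_ac)
  show "L i ^ m i dvd F" unfolding eq by simp
  show "\<not> L i ^ Suc (m i) dvd F"
  proof
    assume "L i ^ Suc (m i) dvd F"
    then have "L i dvd const c * mon (m(i := 0))"
      unfolding eq using L_nonzero[OF assms] by (simp add: mult.commute[of "L i"])
    then have "L i dvd mon (m(i := 0))"
      using is_unit_const[OF c] by (simp add: dvd_mult_unit_iff')
    then show False using not_L_dvd_mon[OF assms, of "m(i := 0)"] by simp
  qed
qed

lemma multiplicities_of_components:
  "{1 / real (multiplicity g F) | g. irreducible g \<and> g dvd F \<and> at_origin g = 0}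
     = (\<lambda>i. 1 / real (m i)) ` {..<n}"
proof (intro equalityI subsetI)
  fix r assume "r \<in> {1 / real (multiplicity g F) | g. irreducible g \<and> g dvd F \<and> at_origin g = 0}"
  then obtain g where r: "r = 1 / real (multiplicity g F)" and g: "irreducible g" "g dvd F"
    by blast
  then have prime: "prime_elem g" by (intro irreducible_imp_prime_elem)
  have "g dvd mon m"
    using g(2) is_unit_const[OF c] unfolding F by (simp add: dvd_mult_unit_iff')
  then obtain i where "i \<in> {..<n}" "g dvd L i ^ m i"
    unfolding mon_def by (rule prime_elem_dvd_prodE[OF finite_lessThan prime])
  then have i: "i < n" and "g dvd L i" using prime prime_elem_dvd_power by auto
  then obtain u where u: "L i = g * u" by (auto elim: dvdE)
  moreover have "irreducible (L i)" using prime_L[OF i] by (rule prime_elem_imp_irreducible)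
  ultimately have "is_unit u"
    using prime_elem_not_unit[OF prime] by (auto dest: irreducibleD)
  then have "multiplicity g F = multiplicity (L i) F"
    unfolding u by (simp add: mult.commute[of g] multiplicity_times_unit_left)
  then show "r \<in> (\<lambda>i. 1 / real (m i)) ` {..<n}"
    using i by (simp add: r multiplicity_L)
next
  fix r assume "r \<in> (\<lambda>i. 1 / real (m i)) ` {..<n}"
  then obtain i where i: "i < n" "r = 1 / real (multiplicity (L i) F)"
    using multiplicity_L by auto
  moreover have "irreducible (L i)" using prime_L[OF i(1)] by (rule prime_elem_imp_irreducible)
  moreover have "at_origin (L i) = 0"
    using form[OF i(1)] by (metis form_one_conv_lin at_origin_lin)
  moreover have "L i dvd F"
    using multiplicity_L[OF i(1)] m[OF i(1)] multiplicity_dvd' [of 1 "L i" F] by simp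
  ultimately show "r \<in> {1 / real (multiplicity g F) | g. irreducible g \<and> g dvd F \<and> at_origin g = 0}"
    by blast
qed

text \<open>
  Each line divides \<open>s\<close> or \<open>t\<close>, because it passes through the origin and \<open>v\<close> does not vanish there. Two
  different lines cannot both divide \<open>s\<close>: the linear part of \<open>s\<close> would vanish, and \<open>s\<close>, \<open>t\<close> would not
  be parameters.
\<close>

lemma snc_imp_at_most_two_lines:
  assumes "snc_at_origin F"
  shows "n \<le> 2"
proof (rule ccontr)
  assume "\<not> n \<le> 2"
  obtain s t u v a b where st: "at_origin s = 0" "at_origin t = 0" "at_origin (jacobian (s, t)) \<noteq> 0"
    and uv: "at_origin u \<noteq> 0" "at_origin v \<noteq> 0" and eq: "u * F = v * s ^ a * t ^ b"
    using assms unfolding snc_at_origin_def by blast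
  have L_dvd: "L i dvd s \<or> L i dvd t" if less: "i < n" for i
  proof -
    have "L i dvd F"
      using multiplicity_L[OF that] m[OF that] multiplicity_dvd' [of 1 "L i" F] by simp
    then have "L i dvd v * s ^ a * t ^ b" unfolding eq[symmetric] by simp
    then have "L i dvd v \<or> L i dvd s ^ a \<or> L i dvd t ^ b"
      using prime_L[OF that] by (simp add: prime_elem_dvd_mult_iff disj_assoc)
    moreover have "\<not> L i dvd v"
    proof
      assume "L i dvd v"
      then obtain h where "v = L i * h" ..
      moreover have "at_origin (L i) = 0"
        using form[OF less] by (metis form_one_conv_lin at_origin_lin)
      ultimately show False using uv by simp
    qed
    ultimately show ?thesis using prime_L[OF that] prime_elem_dvd_power by blast
  qed
  have not_both: False if ij: "i < n" "j < n" "i \<noteq> j" and dvd: "L i dvd w" "L j dvd w"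
    and w: "w = s \<or> w = t" for i j w
  proof -
    obtain \<alpha> \<beta> where i: "L i = lin \<alpha> \<beta>" using form[OF ij(1)] by (rule form_one_conv_lin)
    obtain \<gamma> \<delta> where j: "L j = lin \<gamma> \<delta>" using form[OF ij(2)] by (rule form_one_conv_lin)
    have det: "\<alpha> * \<delta> - \<beta> * \<gamma> \<noteq> 0"
      using cop[OF ij] unfolding i j by (rule coprime_lin_imp_det_nonzero)
    obtain g where g: "w = lin \<alpha> \<beta> * g" using dvd(1) unfolding i ..
    obtain h where h: "w = lin \<gamma> \<delta> * h" using dvd(2) unfolding j ..
    have linear_part: "coeff (coeff (lin \<alpha>' \<beta>' * f) 0) 1 = \<alpha>' * at_origin f"
      "coeff (coeff (lin \<alpha>' \<beta>' * f) 1) 0 = \<beta>' * at_origin f" for \<alpha>' \<beta>' :: complex and f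
      by (simp_all add: lin_def at_origin_def coeff_pCons)
    have eqs: "\<alpha> * at_origin g = \<gamma> * at_origin h" "\<beta> * at_origin g = \<delta> * at_origin h"
      using linear_part[of \<alpha> \<beta> g] linear_part[of \<gamma> \<delta> h]
      unfolding g[symmetric] h[symmetric] by simp_all
    have "(\<alpha> * \<delta> - \<beta> * \<gamma>) * at_origin g = \<delta> * (\<alpha> * at_origin g) - \<gamma> * (\<beta> * at_origin g)"
      by (simp add: algebra_simps)
    also have "\<dots> = 0" unfolding eqs by simp
    finally have "(\<alpha> * \<delta> - \<beta> * \<gamma>) * at_origin g = 0" .
    with det have "at_origin g = 0" by simp
    then have "coeff (coeff w 0) 1 = 0" "coeff (coeff w 1) 0 = 0"
      using linear_part[of \<alpha> \<beta> g] g by auto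
    moreover have "at_origin (jacobian (s, t))
        = coeff (coeff s 0) 1 * coeff (coeff t 1) 0 - coeff (coeff s 1) 0 * coeff (coeff t 0) 1"
      by (simp add: jacobian_def at_origin_def coeff_mult_0 coeff_map_poly coeff_pderiv)
    ultimately show False using st(3) w by auto
  qed
  have "0 < n" "1 < n" "2 < n" using \<open>\<not> n \<le> 2\<close> by auto
  with L_dvd[of 0] L_dvd[of 1] L_dvd[of 2] not_both[of 0 1] not_both[of 0 2] not_both[of 1 2]
  show False by auto
qed

text \<open>
  A nonempty set of centres contains the origin, whose exceptional curve contributes \<open>2 / D\<close>. If there
  are no centres, then this value is not in the set over which the minimum is taken; but then there
  are at most two lines, and one of them has at least half of the total multiplicity.
\<close>

lemma lct_on_eq_threshold:
  assumes T: "log_resolution F T"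
  shows "lct_on T F = threshold"
  unfolding lct_on_def multiplicities_of_components
proof (rule Min_eqI)
  have adm: "admissible_centres T" using T by (simp add: log_resolution_def)
  then have "finite T" by (simp add: admissible_centres_def)
  then show "finite ({(real (ord_exc_canonical w) + 1) / real (ord_exc w F) | w. w \<in> T}
      \<union> (\<lambda>i. 1 / real (m i)) ` {..<n})" by simp
  show "threshold \<le> r" if "r \<in> {(real (ord_exc_canonical w) + 1) / real (ord_exc w F) | w. w \<in> T}
      \<union> (\<lambda>i. 1 / real (m i)) ` {..<n}" for r
    using that threshold_le_exceptional threshold_le(2) by auto
  have "threshold \<in> insert (2 / deg m) ((\<lambda>i. 1 / m i) ` {..<n})"
    unfolding threshold_def by (rule Min_in) auto
  moreover have "2 / deg m \<in> {(real (ord_exc_canonical w) + 1) / real (ord_exc w F) | w. w \<in> T}"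
    if "T \<noteq> {}"
  proof -
    have "[] \<in> T" using that Nil_mem_admissible[OF adm] by blast
    then show ?thesis using first_blowup by force
  qed
  moreover have "threshold \<in> (\<lambda>i. 1 / m i) ` {..<n}" if "T = {}"
  proof -
    have "snc_at_origin (pull_back [] F * jacobian (chart_map []))"
      using T that by (auto simp: log_resolution_def points_over_origin_def)
    moreover have "pull_back [] F = F"
    proof -
      have "pull_back [] (L i) = L i" if less: "i < n" for i
      proof -
        obtain \<alpha> \<beta> where "L i = lin \<alpha> \<beta>" using form[OF less] by (rule form_one_conv_lin)
        then show ?thesis using pull_back_lin[of "[]"] by (simp add: lin_conv_vars)
      qed
      then show ?thesis unfolding pull_back_F unfolding F mon_def by simp
    qed
    ultimately have "n \<le> 2" by (intro snc_imp_at_most_two_lines) (simp add: jacobian_vars)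
    then have "n = 1 \<or> n = 2" using n by auto
    then have "\<exists>i<n. deg m \<le> 2 * m i"
    proof
      assume "n = 1"
      then have "deg m = m 0" unfolding deg_def by simp
      with \<open>n = 1\<close> show ?thesis by (intro exI[of _ 0]) linarith
    next
      assume "n = 2"
      then have "deg m = m 0 + m 1" unfolding deg_def by (simp add: numeral_2_eq_2)
      then have "deg m \<le> 2 * m 0 \<or> deg m \<le> 2 * m 1" by linarith
      moreover have "0 < n" "1 < n" using \<open>n = 2\<close> by simp_all
      ultimately show ?thesis by blast
    qed
    then obtain i where i: "i < n" "deg m \<le> 2 * m i" by blast
    have "0 < deg m" unfolding deg_def using m n by (intro sum_pos) auto
    moreover have "real (deg m) \<le> real (2 * m i)" using i(2) by (simp only: of_nat_le_iff)
    ultimately have le: "1 / m i \<le> 2 / deg m" using m[OF i(1)] by (simp add: field_simps)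
    show ?thesis
    proof (cases "threshold = 2 / deg m")
      case True
      with le threshold_le(2)[OF i(1)] have "threshold = 1 / m i" by linarith
      with i(1) show ?thesis by auto
    next
      case False
      have "threshold \<in> insert (2 / deg m) ((\<lambda>i. 1 / m i) ` {..<n})"
        unfolding threshold_def by (rule Min_in) auto
      with False show ?thesis by blast
    qed
  qed
  ultimately show "threshold \<in> {(real (ord_exc_canonical w) + 1) / real (ord_exc w F) | w. w \<in> T}
      \<union> (\<lambda>i. 1 / real (m i)) ` {..<n}"
    by (cases "T = {}") auto
qed

lemma lct_eq_threshold: "lct F = threshold"
  unfolding lct_def
proof (rule the_equality)
  show "\<exists>T. log_resolution F T \<and> threshold = lct_on T F"
    using log_resolution_by_one_blowup lct_on_eq_threshold by metis
qed (auto simp: lct_on_eq_threshold)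

end

end

section \<open>Binary forms with prescribed multiplicities\<close>

text \<open>
  The list of factors becomes a family indexed by its positions; the family of multiplicities is
  recovered as a multiset, which is all that the fields of different characteristic share.
\<close>

lemma splits_with_multsE:
  assumes "splits_with_mults F M"
  obtains c L n m where "c \<noteq> 0" "coprime_linear_forms L n" "F = const c * coprime_linear_forms.mon L n m"
    "M = mset (map m [0..<n])" "\<And>i. i < n \<Longrightarrow> 0 < m i"
proof -
  obtain c ls where c: "c \<noteq> 0" and ls: "\<forall>(l, m) \<in> set ls. is_form 1 l \<and> 0 < m"
    and sorted: "sorted_wrt (\<lambda>(l, _) (l', _). coprime l l') ls"
    and F: "F = const c * (\<Prod>(l, m)\<leftarrow>ls. l ^ m)" and M: "M = mset (map snd ls)"
    using assms unfolding splits_with_mults_def by blast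
  define n where "n = length ls"
  define L where "L = (\<lambda>i. fst (ls ! i))"
  define m where "m = (\<lambda>i. snd (ls ! i))"
  have ls': "is_form 1 (L i) \<and> 0 < m i" if "i < n" for i
    using ls nth_mem[of i ls] that unfolding n_def L_def m_def by (fastforce simp: case_prod_beta)
  have less: "coprime (L i) (L j)" if "i < j" "j < n" for i j
    using sorted that unfolding sorted_wrt_iff_nth_less n_def L_def by (fastforce simp: case_prod_beta)
  have forms: "coprime_linear_forms L n"
  proof
    show "is_form 1 (L i)" if "i < n" for i using ls'[OF that] ..
    show "coprime (L i) (L j)" if "i < n" "j < n" "i \<noteq> j" for i j
      using that less[of i j] less[of j i] by (cases "i < j") (auto simp: coprime_commute)
  qed
  have "(\<Prod>(l, m)\<leftarrow>ls. l ^ m) = (\<Prod>x\<leftarrow>map (\<lambda>i. ls ! i) [0..<n]. fst x ^ snd x)"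
    unfolding n_def map_nth by (simp only: case_prod_beta')
  also have "\<dots> = coprime_linear_forms.mon L n m"
    unfolding coprime_linear_forms.mon_def[OF forms]
    by (simp add: L_def m_def prod.distinct_set_conv_list[symmetric] atLeast0LessThan comp_def)
  finally have "F = const c * coprime_linear_forms.mon L n m" by (simp add: F)
  moreover have "map snd ls = map m [0..<n]"
    unfolding m_def n_def by (intro nth_equalityI) auto
  ultimately show ?thesis using that[of c L n m] c forms M ls' by simp
qed

lemma sum_mset_map_upt: "sum_mset (mset (map m [0..<n])) = (\<Sum>i<n. m i)"
  by (simp only: sum_mset_sum_list interv_sum_list_conv_sum_set_nat set_upt atLeast0LessThan)

lemma set_mset_map_upt: "set_mset (mset (map m [0..<n])) = m ` {..<n}"
  by (simp add: atLeast0LessThan)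

lemma lct_of_splitting:
  fixes F :: "complex bipoly"
  assumes F: "splits_with_mults F M" and M: "M \<noteq> {#}"
  shows "lct F = Min (insert (2 / sum_mset M) ((\<lambda>k. 1 / real k) ` set_mset M))"
    and "k \<in># M \<Longrightarrow> \<exists>l. is_form 1 l \<and> l dvd F \<and> multiplicity l F = k"
proof -
  obtain c L n m where s: "c \<noteq> 0" "coprime_linear_forms L n"
    "F = const c * coprime_linear_forms.mon L n m"
    "M = mset (map m [0..<n])" and m: "\<And>i. i < n \<Longrightarrow> 0 < m i"
    by (rule splits_with_multsE[OF F]) blast
  interpret coprime_linear_forms L n by (rule s(2))
  interpret complex_linear_forms L n ..
  have n: "0 < n" using M s(4) by (cases n) auto
  note ctx = s(1) m n s(3)
  show "lct F = Min (insert (2 / sum_mset M) ((\<lambda>k. 1 / real k) ` set_mset M))"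
    using lct_eq_threshold[OF ctx] threshold_def[OF ctx]
    unfolding s(4) sum_mset_map_upt set_mset_map_upt deg_def by (simp add: image_image)
  show "\<exists>l. is_form 1 l \<and> l dvd F \<and> multiplicity l F = k" if "k \<in># M"
  proof -
    obtain i where i: "i < n" "k = m i" using \<open>k \<in># M\<close> by (auto simp: s(4))
    have "multiplicity (L i) F = k" using multiplicity_L[OF ctx i(1)] i(2) by simp
    moreover from this have "L i dvd F"
      using m[OF i(1)] i(2) multiplicity_dvd'[of 1 "L i" F] by simp
    ultimately show ?thesis using form[OF i(1)] by blast
  qed
qed

lemma fpt_of_splitting:
  fixes F :: "'a::field bipoly"
  assumes F: "splits_with_mults F M" and M: "M \<noteq> {#}" and char: "prime CHAR('a)"
  shows "0 < fpt F" "fpt F \<le> 2 / sum_mset M" "k \<in># M \<Longrightarrow> fpt F \<le> 1 / real k"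
    and "fpt F < 2 / sum_mset M \<Longrightarrow>
           \<exists>k e s. k \<in># M \<and> 0 < k \<and> fpt F * real (k * CHAR('a) ^ e) = real s"
proof -
  obtain c L n m where s: "c \<noteq> 0" "coprime_linear_forms L n"
    "F = const c * coprime_linear_forms.mon L n m"
    "M = mset (map m [0..<n])" and m: "\<And>i. i < n \<Longrightarrow> 0 < m i"
    by (rule splits_with_multsE[OF F]) blast
  interpret coprime_linear_forms L n by (rule s(2))
  have n: "0 < n" using M s(4) by (cases n) auto
  note ctx = char s(1) m n s(3)
  have sum: "sum_mset M = deg m" by (simp only: s(4) sum_mset_map_upt deg_def)
  have mem: "k \<in># M \<longleftrightarrow> (\<exists>i<n. k = m i)" for k by (auto simp: s(4))
  show "0 < fpt F" by (rule fpt_pos[OF ctx])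
  show "fpt F \<le> 2 / sum_mset M" unfolding sum by (rule fpt_le_two_div_degree[OF ctx])
  show "fpt F \<le> 1 / real k" if "k \<in># M"
    using that fpt_le_inverse_multiplicity[OF ctx] by (auto simp: mem)
  show "\<exists>k e s. k \<in># M \<and> 0 < k \<and> fpt F * real (k * CHAR('a) ^ e) = real s"
    if "fpt F < 2 / sum_mset M"
    using fpt_less_two_div_degree_imp[OF ctx that[unfolded sum]] m mem by metis
qed

section \<open>Denominators\<close>

lemma minimal_denominator_coprime:
  assumes "coprime u v" "0 < v"
  shows "minimal_denominator (real u / real v) v"
  unfolding minimal_denominator_def
proof (intro conjI allI impI)
  show "0 < v" by fact
  show "real v * (real u / real v) \<in> \<int>" using assms(2) by simp
  fix k :: nat assume k: "0 < k" "real k * (real u / real v) \<in> \<int>"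
  then obtain z where "real k * (real u / real v) = of_int z" by (auto elim: Ints_cases)
  then have "real_of_int (int k * int u) = real_of_int (z * int v)"
    using assms(2) by (simp add: field_simps)
  then have "int k * int u = z * int v" by (simp only: of_int_eq_iff)
  then have "int v dvd int (k * u)" by simp
  then have "v dvd k * u" by (simp only: int_dvd_int_iff)
  then have "v dvd k" using assms(1) by (simp add: coprime_dvd_mult_left_iff coprime_commute)
  then show "v \<le> k" using k(1) by (rule dvd_imp_le)
qed

text \<open>
  In lowest terms the denominator divides \<open>k * p ^ E\<close>. Its prime-to-\<open>p\<close> part divides \<open>k\<close>, and it cannot
  be all of the denominator since \<open>r * k\<close> is not an integer.
\<close>

lemma minimal_denominator_divisible_by_prime:
  fixes p k E s :: nat
  assumes p: "prime p" and k: "0 < k" and r: "r * real (k * p ^ E) = real s" and nint: "r * real k \<notin> \<int>"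
  shows "\<exists>k' e. 1 \<le> e \<and> k' dvd k \<and> minimal_denominator r (k' * p ^ e)"
proof -
  define N where "N = k * p ^ E"
  have N: "0 < N" using p k by (simp add: N_def prime_gt_0_nat)
  define u where "u = s div gcd s N"
  define v where "v = N div gcd s N"
  have uv: "s = u * gcd s N" "N = v * gcd s N" by (simp_all add: u_def v_def)
  have g: "0 < gcd s N" using N by simp
  have v: "0 < v" using uv(2) N by (cases v) auto
  have cop: "coprime u v"
    unfolding u_def v_def using N by (intro div_gcd_coprime) auto
  have "r = real s / real N" using r N by (simp add: N_def field_simps)
  also have "\<dots> = (real u * real (gcd s N)) / (real v * real (gcd s N))"
    using uv by (metis of_nat_mult)
  also have "\<dots> = real u / real v" using g by simp
  finally have r_uv: "r = real u / real v" .
  obtain k' where k': "v = p ^ multiplicity p v * k'" "\<not> p dvd k'"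
    using multiplicity_decompose'[of v p] v p by (auto simp: prime_nat_iff)
  have "k' dvd N" using k'(1) uv(2) by (metis dvd_mult_right dvd_triv_left)
  moreover have "coprime k' (p ^ E)"
    using prime_imp_coprime[OF p k'(2)] by (simp add: coprime_commute)
  ultimately have "k' dvd k" by (simp add: N_def coprime_dvd_mult_left_iff)
  moreover have "1 \<le> multiplicity p v"
  proof (rule ccontr)
    assume "\<not> 1 \<le> multiplicity p v"
    then have "v = k'" using k'(1) by (cases "multiplicity p v") simp_all
    with \<open>k' dvd k\<close> obtain j where "k = v * j" by auto
    then have "r * real k = of_nat (u * j)" using v by (simp add: r_uv)
    with nint show False by (metis Ints_of_nat)
  qed
  moreover have "minimal_denominator r (k' * p ^ multiplicity p v)"
    using minimal_denominator_coprime[OF cop v] k'(1) by (simp add: r_uv mult.commute)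
  ultimately show ?thesis by blast
qed


section \<open>Binary forms over the rationals\<close>

theorem theorem7p7:
  fixes G\<^sub>0 :: "rat bipoly" and d :: nat
  assumes "is_form d G\<^sub>0" and "0 < d"
    and "good_prime TYPE('p::prime_card) G\<^sub>0"
    and "fpt (reduction G\<^sub>0 :: 'p mod_ring bipoly) \<noteq> lct (map_bipoly of_rat G\<^sub>0)"
  shows "\<exists>k e l. 1 \<le> e \<and>
           is_form 1 l \<and> l dvd (map_bipoly of_rat G\<^sub>0 :: complex bipoly) \<and>
           k dvd multiplicity l (map_bipoly of_rat G\<^sub>0) \<and>
           minimal_denominator (fpt (reduction G\<^sub>0 :: 'p mod_ring bipoly)) (k * CARD('p) ^ e)"
proof -
  let ?G = "map_bipoly of_rat G\<^sub>0 :: complex bipoly"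
  let ?Gp = "map_bipoly to_ac (reduction G\<^sub>0) :: 'p mod_ring alg_closure bipoly"
  define c where "c = fpt (reduction G\<^sub>0 :: 'p mod_ring bipoly)"
  have c_eq: "c = fpt ?Gp" by (simp add: c_def fpt_map_to_ac)
  have char_eq: "CHAR('p mod_ring alg_closure) = CARD('p)" by simp
  have prime: "prime CARD('p)" by (rule prime_card)
  obtain M where M: "splits_with_mults ?G M" "splits_with_mults ?Gp M"
    using assms(3) by (auto simp: good_prime_def)
  have M_nonempty: "M \<noteq> {#}"
  proof
    assume "M = {#}"
    then obtain a where "a \<noteq> 0" "?G = const a"
      using M(1) unfolding splits_with_mults_def by auto
    then have "coeff (coeff ?G 0) 0 \<noteq> 0" by (simp add: const_def)
    then have "coeff (coeff G\<^sub>0 0) 0 \<noteq> 0" by (auto simp: map_bipoly_def coeff_map_poly)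
    then show False using assms(1,2) unfolding is_form_def by force
  qed
  note lct = lct_of_splitting[OF M(1) M_nonempty]
  note fpt = fpt_of_splitting[OF M(2) M_nonempty, unfolded char_eq, folded c_eq, OF prime]
  have fin: "finite (insert (2 / sum_mset M) ((\<lambda>k. 1 / real k) ` set_mset M))" by simp
  have "c \<le> lct ?G" unfolding lct(1) using fpt(2,3) by (subst Min_ge_iff[OF fin]) auto
  with assms(4) have less: "c < lct ?G" by (simp add: c_def)
  then have "c < 2 / sum_mset M" unfolding lct(1) using Min_le[OF fin, of "2 / sum_mset M"] by simp
  then obtain k e s where k: "k \<in># M" "0 < k" and s: "c * real (k * CARD('p) ^ e) = real s"
    using fpt(4) by blast
  have "c * real k \<notin> \<int>"
  proof
    assume "c * real k \<in> \<int>"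
    moreover have "c < 1 / real k"
      using less Min_le[OF fin, of "1 / real k"] k(1) unfolding lct(1) by simp
    then have "0 < c * real k" "c * real k < 1" using fpt(1) k(2) by (simp_all add: field_simps)
    ultimately show False using Ints_nonzero_abs_less1 by force
  qed
  then obtain k' e' where "1 \<le> e'" "k' dvd k" "minimal_denominator c (k' * CARD('p) ^ e')"
    using minimal_denominator_divisible_by_prime[OF prime k(2) s] by blast
  moreover obtain l where "is_form 1 l" "l dvd ?G" "multiplicity l ?G = k"
    using lct(2)[OF k(1)] by blast
  ultimately show ?thesis unfolding c_def by blast
qed

end
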